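(* For every real $p\ge1$ there exists a constant $c_p<\infty$ such that $$d_p(Y_n,Y)\le \frac{c_p}{\sqrt n}\qquad\text{for all } n\ge1.$$
   Context: Let $X_n$ be the number of comparisons used by randomized Quicksort (pivot chosen uniformly at random) to sort $n$ distinct numbers. Equivalently, $X_0=0$ and for $n\ge1$, $$X_n \stackrel{d}{=} X_{U_n-1}+X^*_{n-U_n}+n-1,$$ where $U_n$ is uniform on $\{1,\dots,n\}$, $X_j^*\stackrel{d}{=}X_j$, and all these variables are independent. Let $\mu_n:=\mathbf E X_n=2(n+1)H_n-4n$, where $H_n=\sum_{k\le n}1/k$. For $n\ge1$ set $Y_n:=(X_n-\mu_n)/n$. $Y$ is the distributional limit of $Y_n$. Its law is the unique law with mean $0$ and finite variance satisfying $Y\stackrel{d}{=}UY+(1-U)Y^*+C(U)$, where $U\sim\mathrm{unif}(0,1)$, $Y^*\stackrel{d}{=}Y$, $U,Y,Y^*$ are independent, and $C(u)=2u\ln u+2(1-u)\ln(1-u)+1$. All moments of $Y$ are finite. $d_p(X,Y):=\min\|X'-Y'\|_p$, the minimum taken over all couplings $(X',Y')$ with $X'\stackrel{d}{=}X$ and $Y'\stackrel{d}{=}Y$. *)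

theory Defs
  imports "HOL-Probability.Probability"
begin

(* Laws of X_0, ..., X_n, built by the distributional recursion
   X_n = X_{U_n - 1} + X*_{n - U_n} + n - 1,  U_n uniform on {1..n}. *)
definition qs_step :: "nat pmf list \<Rightarrow> nat pmf" where
  "qs_step xs = (if xs = [] then return_pmf 0 else
     bind_pmf (pmf_of_set {1..length xs}) (\<lambda>u.
       bind_pmf (xs ! (u - 1)) (\<lambda>a.
         bind_pmf (xs ! (length xs - u)) (\<lambda>b.
           return_pmf (a + b + length xs - 1)))))"

primrec qs_laws :: "nat \<Rightarrow> nat pmf list" where
  "qs_laws 0 = []"
| "qs_laws (Suc n) = qs_laws n @ [qs_step (qs_laws n)]"

definition X_law :: "nat \<Rightarrow> nat pmf" where
  "X_law n = qs_laws (Suc n) ! n"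

definition mu :: "nat \<Rightarrow> real" where
  "mu n = 2 * (real n + 1) * (\<Sum>k=1..n. 1 / real k) - 4 * real n"

definition Y_law :: "nat \<Rightarrow> real measure" where
  "Y_law n = distr (measure_pmf (X_law n)) borel (\<lambda>k. (real k - mu n) / real n)"

definition Ctoll :: "real \<Rightarrow> real" where
  "Ctoll u = 2 * u * ln u + 2 * (1 - u) * ln (1 - u) + 1"

definition is_limit_law :: "real measure \<Rightarrow> bool" where
  "is_limit_law M \<longleftrightarrow> real_distribution M
     \<and> weak_conv_m Y_law M
     \<and> integrable M (\<lambda>y. y ^ 2)
     \<and> (\<integral>y. y \<partial>M) = 0
     \<and> M = distr (uniform_measure lborel {0<..<1} \<Otimes>\<^sub>M (M \<Otimes>\<^sub>M M)) borel
              (\<lambda>(u, y, y'). u * y + (1 - u) * y' + Ctoll u)"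

definition coupling :: "(real \<times> real) measure \<Rightarrow> real measure \<Rightarrow> real measure \<Rightarrow> bool" where
  "coupling P M N \<longleftrightarrow> prob_space P \<and> sets P = sets (borel \<Otimes>\<^sub>M borel)
     \<and> distr P borel fst = M \<and> distr P borel snd = N"

definition wass_pow :: "real \<Rightarrow> real measure \<Rightarrow> real measure \<Rightarrow> ennreal" where
  "wass_pow p M N = (INF P\<in>{P. coupling P M N}. \<integral>\<^sup>+ z. ennreal (\<bar>fst z - snd z\<bar> powr p) \<partial>P)"

definition dp :: "real \<Rightarrow> real measure \<Rightarrow> real measure \<Rightarrow> ennreal" where
  "dp p M N = (if wass_pow p M N = \<top> then \<top>
               else ennreal (enn2real (wass_pow p M N) powr (1 / p)))"

end

theory Submission
  imports Defs
begin

text \<open>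
  The coupling of \<open>Y\<^sub>n\<close> and \<open>Y\<close> is built by recursion on \<open>n\<close>: the pivot rank is coupled with \<open>U\<close>, and the two
  subproblems with the two copies of \<open>Y\<close> in the fixed point equation. The same coupling serves every \<open>p\<close>.
  The difference \<open>n * (Y\<^sub>n - Y)\<close> is then the sum of two conditionally independent centred differences
  for the subproblems, a perturbation \<open>O(Y)\<close> and a toll error \<open>O(ln n)\<close>.

  Its second moment satisfies the Quicksort recurrence with a toll of order \<open>sqrt n\<close>, hence is \<open>O(n)\<close>.
  For the moment of order \<open>2 * m\<close>, \<open>m \<ge> 2\<close>, the odd cross terms vanish and the other cross terms are \<open>O(n ^ m)\<close>
  by induction on \<open>m\<close>; at growth \<open>n ^ m\<close> the recurrence contracts by a factor near \<open>2 / (m + 1) < 1\<close>,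
  so the moment is \<open>O(n ^ m)\<close>.
  Comparing \<open>\<bar>x\<bar> powr p\<close> with \<open>1 + x ^ (2 * m)\<close> for \<open>m \<ge> p\<close> gives the rate \<open>n powr (- 1/2)\<close>.
\<close>

section \<open>Power inequalities and recurrences\<close>

text \<open>The rate sits at a threshold. Averaging over the pivot turns growth \<open>n ^ q\<close>
  of a moment into about \<open>2 / (q + 1) * n ^ q\<close>. For the second moment
  \<open>q = 1\<close> and the factor is 1, so no constant-factor loss is allowed: every estimate
  there has leading coefficient 1, or 1 plus a term of order \<open>1 / sqrt j\<close>. For
  \<open>q \<ge> 2\<close> the factor is at most \<open>2/3\<close>, and two losses of
  \<open>9/8\<close> in each step, one for the shift of the weight of \<open>Y\<close> and one for
  the toll, still leave \<open>(9/8)^2 * 2/3 = 27/32 < 1\<close>. This is the origin of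
  \<open>9/8\<close> and \<open>81/64\<close>.

  The second obstacle is that \<open>is_limit_law\<close> supplies only a second moment of
  \<open>Y\<close>, while the perturbation at order \<open>2 * m\<close> costs a moment of
  \<open>Y\<close> of that order. The recursion is therefore written with a parameter
  \<open>\<theta>\<close> that switches \<open>Y\<close> off: at \<open>\<theta> = 0\<close> it
  bounds the moments of \<open>(X_n - mu n) / n\<close> with no knowledge of \<open>Y\<close>, weak
  convergence hands these bounds to \<open>Y\<close>, and this makes the recursion available at
  \<open>\<theta> = 1\<close>.\<close>

lemma even_power_add_le:
  fixes m :: nat
  obtains K :: real where "K \<ge> 0" "\<And>x c :: real. (x + c) ^ (2*m) \<le> 9/8 * x ^ (2*m) + K * c ^ (2*m)"
proof (cases "m = 0")
  case True
  then show ?thesis using that[of 0] by simp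
next
  case False
  \<comment> \<open>The threshold ratio of \<open>c\<close> to \<open>x\<close>: up to it
    \<open>c\<close> is absorbed by the factor \<open>9/8\<close>, beyond it \<open>x\<close> is at
    most \<open>c / d\<close> in size and \<open>c\<close> carries the whole sum.\<close>
  define d where "d = root (2*m) (9/8 :: real) - 1"
  have d: "d > 0" using False by (simp add: d_def)
  have pd: "(1 + d) ^ (2*m) = 9/8" using False by (simp add: d_def)
  define K where "K = (1 + 1/d) ^ (2*m)"
  have K0: "K \<ge> 0" using d by (simp add: K_def)
  have ev: "\<bar>t\<bar> ^ (2*m) = t ^ (2*m)" "0 \<le> t ^ (2*m)" for t :: real by (simp_all add: power_mult)
  have "(x + c) ^ (2*m) \<le> 9/8 * x ^ (2*m) + K * c ^ (2*m)" for x c :: real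
  proof (cases "\<bar>c\<bar> \<le> d * \<bar>x\<bar>")
    case True
    have "\<bar>x + c\<bar> ^ (2*m) \<le> ((1 + d) * \<bar>x\<bar>) ^ (2*m)"
      using True by (intro power_mono) (auto simp: algebra_simps)
    then have "(x + c) ^ (2*m) \<le> 9/8 * x ^ (2*m)" unfolding power_mult_distrib pd ev .
    then show ?thesis using mult_nonneg_nonneg[OF K0 ev(2)[of c]] by linarith
  next
    case F: False
    have "\<bar>x\<bar> \<le> \<bar>c\<bar> / d" using F d by (simp add: field_simps)
    then have "\<bar>x + c\<bar> \<le> (1 + 1/d) * \<bar>c\<bar>" by (simp add: algebra_simps)
    then have "\<bar>x + c\<bar> ^ (2*m) \<le> ((1 + 1/d) * \<bar>c\<bar>) ^ (2*m)"
      by (intro power_mono) auto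
    then have "(x + c) ^ (2*m) \<le> K * c ^ (2*m)" unfolding power_mult_distrib ev K_def .
    then show ?thesis using ev(2)[of x] by linarith
  qed
  then show ?thesis using that K0 by blast
qed

lemma power_product_le_extremes:
  fixes a b :: real
  assumes "a \<ge> 0" "b \<ge> 0" "i \<le> r"
  shows "a ^ i * b ^ (r - i) \<le> a ^ r + b ^ r"
proof -
  have "a ^ i * b ^ (r - i) \<le> max a b ^ i * max a b ^ (r - i)"
    using assms by (intro mult_mono power_mono) auto
  also have "\<dots> = max a b ^ r" using assms by (simp flip: power_add)
  also have "\<dots> \<le> a ^ r + b ^ r" using assms by (auto simp: max_def)
  finally show ?thesis .
qed

text \<open>The terms linear in \<open>a\<close> or in \<open>b\<close> are kept exactly, with sign,
  because they have mean zero for independent centred summands. Every other mixed term contains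
  \<open>a^2 * b^2\<close>; the remaining degree \<open>2 * m - 4\<close> is even, so absolute
  values disappear once its product is bounded by the two extreme powers. The constant
  \<open>4 ^ m\<close> is the sum of all binomial coefficients.\<close>

lemma even_power_binomial_le:
  fixes a b :: real and m :: nat
  assumes "m \<ge> 2"
  shows "(a + b) ^ (2*m) \<le> a ^ (2*m) + b ^ (2*m) + 2 * real m * (a ^ (2*m-1) * b + a * b ^ (2*m-1))
           + 4 ^ m * (a ^ (2*(m-1)) * b\<^sup>2 + a\<^sup>2 * b ^ (2*(m-1)))"
proof -
  obtain l where l: "m = Suc (Suc l)" using assms by (metis add_2_eq_Suc le_Suc_ex)
  define r where "r = 2 * l"
  have N: "2 * m = Suc (Suc (Suc (Suc r)))" by (simp add: l r_def)
  define T where "T = (\<lambda>i. real (2*m choose i) * a ^ i * b ^ (2*m - i))"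
  define S where "S = a ^ (2*(m-1)) * b\<^sup>2 + a\<^sup>2 * b ^ (2*(m-1))"
  have "(a + b) ^ (2*m) = (\<Sum>i\<le>2*m. T i)" by (simp add: binomial_ring T_def)
  also have "\<dots> = T (2*m) + T (2*m-1) + T 0 + T 1 + (\<Sum>i\<le>r. T (Suc (Suc i)))"
  proof -
    have "(\<Sum>i\<le>Suc (Suc r). T i) = T 0 + T 1 + (\<Sum>i\<le>r. T (Suc (Suc i)))"
      by (simp only: sum.atMost_Suc_shift) simp
    then show ?thesis unfolding N sum.atMost_Suc[of _ "Suc (Suc (Suc r))"] sum.atMost_Suc[of _ "Suc (Suc r)"]
      by simp
  qed
  also have "T (2*m) = a ^ (2*m)" by (simp add: T_def)
  also have "T (2*m-1) = 2 * real m * a ^ (2*m-1) * b"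
    unfolding T_def N by (simp add: l r_def)
  also have "T 0 = b ^ (2*m)" by (simp add: T_def)
  also have "T 1 = 2 * real m * a * b ^ (2*m-1)" by (simp add: T_def)
  also have "(\<Sum>i\<le>r. T (Suc (Suc i))) \<le> (\<Sum>i\<le>r. real (2*m choose Suc (Suc i)) * S)"
  proof (rule sum_mono)
    fix i assume i: "i \<in> {..r}"
    have "a ^ Suc (Suc i) * b ^ (2*m - Suc (Suc i)) \<le> \<bar>a ^ Suc (Suc i) * b ^ (2*m - Suc (Suc i))\<bar>"
      by simp
    also have "\<dots> = a\<^sup>2 * b\<^sup>2 * (\<bar>a\<bar> ^ i * \<bar>b\<bar> ^ (r - i))"
    proof -
      have e: "2*m - Suc (Suc i) = 2 + (r - i)" using i by (simp add: N)
      show ?thesis unfolding e abs_mult power_abs power_add power_Suc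
        by (simp add: power2_eq_square algebra_simps)
    qed
    also have "\<dots> \<le> a\<^sup>2 * b\<^sup>2 * (\<bar>a\<bar> ^ r + \<bar>b\<bar> ^ r)"
      using i by (intro mult_left_mono power_product_le_extremes) auto
    also have "\<dots> = a\<^sup>2 * b\<^sup>2 * (a ^ r + b ^ r)" by (simp add: r_def power_mult)
    also have "\<dots> = S"
      by (simp add: S_def l r_def algebra_simps power2_eq_square)
    finally show "T (Suc (Suc i)) \<le> real (2*m choose Suc (Suc i)) * S"
      unfolding T_def by (simp only: mult.assoc) (intro mult_left_mono, auto)
  qed
  also have "\<dots> = (\<Sum>i\<in>(\<lambda>i. Suc (Suc i)) ` {..r}. real (2*m choose i)) * S"
    by (subst sum.reindex) (auto simp: sum_distrib_right inj_on_def)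
  also have "\<dots> \<le> (\<Sum>i\<le>2*m. real (2*m choose i)) * S"
  proof (intro mult_right_mono sum_mono2)
    show "S \<ge> 0" by (auto simp: S_def)
  qed (auto simp: N)
  also have "(\<Sum>i\<le>2*m. real (2*m choose i)) = 4 ^ m"
    using choose_row_sum[of "2*m"] by (simp flip: of_nat_sum add: power_mult)
  finally show ?thesis unfolding S_def by (simp add: algebra_simps)
qed

section \<open>Recurrences of Quicksort type\<close>

lemma sum_power_lessThan_le:
  assumes "q \<ge> 2"
  shows "3 * (\<Sum>j<n. real j ^ q) \<le> real n ^ (q + 1)"
proof -
  have sq: "3 * (\<Sum>j<n. real j ^ 2) \<le> real n ^ 3"
    by (induction n) (auto simp: power2_eq_square power3_eq_cube algebra_simps)
  have "(\<Sum>j<n. real j ^ q) \<le> (\<Sum>j<n. real j ^ 2 * real n ^ (q - 2))"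
  proof (rule sum_mono)
    fix j assume "j \<in> {..<n}"
    then have "real j ^ 2 * real j ^ (q - 2) \<le> real j ^ 2 * real n ^ (q - 2)"
      by (intro mult_left_mono power_mono) auto
    moreover have "real j ^ 2 * real j ^ (q - 2) = real j ^ q"
    proof -
      have "2 + (q - 2) = q" using assms by simp
      then show ?thesis using power_add[of "real j" 2 "q - 2"] by (simp only:)
    qed
    ultimately show "real j ^ q \<le> real j ^ 2 * real n ^ (q - 2)" by simp
  qed
  then have "3 * (\<Sum>j<n. real j ^ q) \<le> (3 * (\<Sum>j<n. real j ^ 2)) * real n ^ (q - 2)"
    by (simp add: sum_distrib_right mult.assoc)
  also have "\<dots> \<le> real n ^ 3 * real n ^ (q - 2)"
    using sq by (intro mult_right_mono) auto
  also have "\<dots> = real n ^ (q + 1)" using assms by (simp flip: power_add)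
  finally show ?thesis .
qed

text \<open>On the trial bound \<open>n ^ q\<close> the averaging gains at least \<open>2/3\<close>,
  the value at \<open>q = 2\<close>, so the total factor is at most
  \<open>81/64 * 2/3 = 27/32\<close>. Any constant from \<open>32/5\<close> on reproduces itself in
  the induction; 7 is the next integer.\<close>

lemma contracting_recurrence_bound:
  fixes f :: "nat \<Rightarrow> real"
  assumes f0: "f 0 = 0" and K: "K \<ge> 0" and q: "q \<ge> 2"
    and rec: "\<And>n. n \<ge> 1 \<Longrightarrow> f n \<le> 81/64 * ((\<Sum>j<n. f j + f (n - 1 - j)) / n) + K * real n ^ q"
  shows "f n \<le> 7 * K * real n ^ q"
proof (induction n rule: less_induct)
  case (less n)
  show ?case
  proof (cases "n = 0")
    case True
    then show ?thesis using f0 q by (simp add: power_0_left)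
  next
    case False
    have "(\<Sum>j<n. f j + f (n - 1 - j)) = 2 * (\<Sum>j<n. f j)"
      using sum.nat_diff_reindex[of f n] by (simp add: sum.distrib)
    also have "\<dots> \<le> 2 * (\<Sum>j<n. 7 * K * real j ^ q)"
      using less by (intro mult_left_mono sum_mono) auto
    also have "\<dots> = 14/3 * K * (3 * (\<Sum>j<n. real j ^ q))" by (simp add: sum_distrib_left)
    also have "\<dots> \<le> 14/3 * K * real n ^ (q + 1)"
      using K by (intro mult_left_mono sum_power_lessThan_le q) auto
    finally have "(\<Sum>j<n. f j + f (n - 1 - j)) / n \<le> 14/3 * K * real n ^ q"
      using False by (simp add: field_simps)
    then have "f n \<le> 81/64 * (14/3 * K * real n ^ q) + K * real n ^ q"
      using rec[of n] False by linarith
    also have "\<dots> = 221/32 * (K * real n ^ q)" by simp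
    also have "\<dots> \<le> 7 * (K * real n ^ q)"
      using K by (intro mult_right_mono) auto
    finally show ?thesis by simp
  qed
qed

lemma sum_sqrt_lessThan_ge: "2/3 * (real n * sqrt n) - sqrt n \<le> (\<Sum>j<n. sqrt (real j))"
proof (induction n)
  case (Suc n)
  have "2/3 * (real (Suc n) * sqrt (Suc n)) - sqrt (Suc n) \<le> 2/3 * (real n * sqrt n)"
  proof -
    \<comment> \<open>With \<open>x^2 = y^2 + 1\<close> the claim becomes
      \<open>x^3 - 3 * x * y^2 + 2 * y^3 \<ge> 0\<close>, and the left side factors as
      \<open>(x - y)^2 * (x + 2 * y)\<close>.\<close>
    define x where "x = sqrt (real (Suc n))"
    define y where "y = sqrt (real n)"
    have x: "x > 0" "y \<ge> 0" "x\<^sup>2 = real n + 1" "y\<^sup>2 = real n" "x \<ge> y" by (auto simp: x_def y_def)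
    have "(x - y)\<^sup>2 * (x + 2 * y) \<ge> 0" using x by auto
    then have "x * x\<^sup>2 - 3 * (x * y\<^sup>2) + 2 * (y * y\<^sup>2) \<ge> 0" by (simp add: power2_eq_square algebra_simps)
    then have "x * (real n + 1) - 3 * (x * real n) + 2 * (y * real n) \<ge> 0" using x by simp
    then have "2/3 * ((real n + 1) * x) - x \<le> 2/3 * (real n * y)"
      by (simp add: algebra_simps)
    then show ?thesis unfolding x_def y_def by (simp add: algebra_simps)
  qed
  then show ?case using Suc by simp
qed simp

text \<open>The homogeneous recurrence is solved exactly by a linear function, so there is no contraction
  to absorb the perturbation; subtracting a multiple of \<open>sqrt n\<close> from the linear bound pays for it.\<close>
lemma critical_recurrence_bound:
  fixes f :: "nat \<Rightarrow> real"
  assumes f0: "f 0 = 0" and K: "K \<ge> 0"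
    and rec: "\<And>n. n \<ge> 1 \<Longrightarrow> f n \<le> 2 / n * (\<Sum>j<n. (1 + 1 / (16 * sqrt (real j + 1))) * f j) + K * sqrt n"
  shows "f n \<le> 12 * K * real n"
proof -
  have "f n \<le> 12 * K * real n - 6 * K * sqrt n"
  proof (induction n rule: less_induct)
    case (less n)
    show ?case
    proof (cases "n = 0")
      case True
      then show ?thesis using f0 by simp
    next
      case False
      have step: "(1 + 1 / (16 * sqrt (real j + 1))) * f j \<le> 12 * K * real j - 21/4 * K * sqrt j"
        if "j < n" for j
      proof -
        have "(1 + 1 / (16 * sqrt (real j + 1))) * f j
            \<le> (1 + 1 / (16 * sqrt (real j + 1))) * (12 * K * real j - 6 * K * sqrt j)"
          using less[OF that] by (intro mult_left_mono) auto
        also have "\<dots> \<le> (12 * K * real j - 6 * K * sqrt j) + 12 * K * real j * (1 / (16 * sqrt (real j + 1)))"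
          using K by (simp add: algebra_simps)
        also have "12 * K * real j * (1 / (16 * sqrt (real j + 1))) \<le> 3/4 * K * sqrt j"
        proof -
          have "real j = sqrt j * sqrt j" by simp
          also have "\<dots> \<le> sqrt j * sqrt (real j + 1)" by (intro mult_left_mono) auto
          finally have "real j / sqrt (real j + 1) \<le> sqrt j"
            by (simp add: divide_le_eq)
          from mult_left_mono[OF this, of "3/4 * K"] K show ?thesis by simp
        qed
        finally show ?thesis by simp
      qed
      have s: "(\<Sum>j<n. real j) = real n * (real n - 1) / 2" by (induction n) (auto simp: field_simps)
      have "(\<Sum>j<n. (1 + 1 / (16 * sqrt (real j + 1))) * f j) \<le> (\<Sum>j<n. 12 * K * real j - 21/4 * K * sqrt (real j))"
        using step by (intro sum_mono) auto
      also have "\<dots> = 12 * K * (\<Sum>j<n. real j) - 21/4 * K * (\<Sum>j<n. sqrt (real j))"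
        by (simp add: sum_subtractf sum_distrib_left)
      also have "\<dots> \<le> 12 * K * (real n * (real n - 1) / 2) - 21/4 * K * (2/3 * (real n * sqrt n) - sqrt n)"
        using K sum_sqrt_lessThan_ge[of n] s by (intro diff_mono mult_left_mono) auto
      finally have "2 / n * (\<Sum>j<n. (1 + 1 / (16 * sqrt (real j + 1))) * f j)
        \<le> 2 / n * (12 * K * (real n * (real n - 1) / 2) - 21/4 * K * (2/3 * (real n * sqrt n) - sqrt n))"
        by (intro mult_left_mono) auto
      \<comment> \<open>The perturbation has reduced the coefficient of \<open>sqrt j\<close> only
        from 6 to \<open>21/4\<close>, and averaging raises it to \<open>2 * 2/3 * 21/4 = 7\<close>.
        The surplus \<open>K * sqrt n\<close> over 6 is exactly the toll. The lower-order rest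
        \<open>21/2 * K\<close> is covered by the \<open>12 * K\<close> gained from
        \<open>n - 1\<close>.\<close>
      also have "\<dots> = 12 * K * (real n - 1) - 7 * K * sqrt n + 21/2 * K * (sqrt n / n)"
        using False by (simp add: field_simps)
      also have "sqrt n / n \<le> 1"
      proof -
        have "sqrt n \<le> sqrt n * sqrt n" using False by (intro mult_le_cancel_left1[THEN iffD2]) auto
        then show ?thesis using False by simp
      qed
      then have "12 * K * (real n - 1) - 7 * K * sqrt n + 21/2 * K * (sqrt n / n)
         \<le> 12 * K * (real n - 1) - 7 * K * sqrt n + 21/2 * K * 1"
        using K by (intro add_left_mono mult_left_mono) auto
      finally show ?thesis using rec[of n] False K by (simp add: algebra_simps)
    qed
  qed
  also have "\<dots> \<le> 12 * K * real n" using K by simp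
  finally show ?thesis .
qed

section \<open>The toll function\<close>

text \<open>The additive term in the recursion for the centred count \<open>X_n - mu n\<close> when
  the subproblems have sizes \<open>j\<close> and \<open>n - 1 - j\<close>.\<close>

definition toll :: "nat \<Rightarrow> nat \<Rightarrow> real" where
  "toll n j = real n - 1 + mu j + mu (n - 1 - j) - mu n"

lemma mu_Suc: "real (Suc n) * mu (Suc n) = (real n + 2) * mu n + 2 * real n"
  by (simp add: mu_def field_simps)

text \<open>The averaged Quicksort recurrence for the mean, recovered from the closed form of
  \<open>mu\<close>; it is what makes the toll centred.\<close>

lemma sum_mu: "2 * (\<Sum>j<n. mu j) = real n * mu n - real n * (real n - 1)"
proof (induction n)
  case (Suc n)
  then show ?case using mu_Suc[of n] by (simp add: algebra_simps)
qed (simp add: mu_def)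

lemma sum_toll: "(\<Sum>j<n. toll n j) = 0"
proof -
  have "(\<Sum>j<n. mu (n - 1 - j)) = (\<Sum>j<n. mu j)"
    using sum.nat_diff_reindex[of mu n] by simp
  then show ?thesis using sum_mu[of n]
    by (simp add: toll_def sum.distrib sum_subtractf algebra_simps)
qed

text \<open>\<open>g n\<close> increases while \<open>g n + 1 / (n + 1)\<close> decreases, both by
  \<open>ln x \<le> x - 1\<close>. The precision \<open>1 / (j + 1)\<close> is what
  \<open>toll_approx\<close> requires, since the difference is multiplied there by
  \<open>j + 1\<close>.\<close>

lemma harmonic_minus_ln_diff:
  fixes j n :: nat
  defines "g \<equiv> \<lambda>n. (\<Sum>k=1..n. 1 / real k) - ln (real n + 1)"
  assumes "j \<le> n"
  shows "g j \<le> g n" "g n \<le> g j + 1 / (real j + 1)"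
proof -
  have up: "g i \<le> g (Suc i)" for i
  proof -
    have "ln (1 + 1 / (real i + 1)) \<le> 1 / (real i + 1)" by (rule ln_add_one_self_le_self) auto
    moreover have "ln (1 + 1 / (real i + 1)) = ln (real i + 2) - ln (real i + 1)"
    proof -
      have "1 + 1 / (real i + 1) = (real i + 2) / (real i + 1)" by (simp add: field_simps)
      then show ?thesis by (simp add: ln_div)
    qed
    ultimately show ?thesis by (simp add: g_def add.commute)
  qed
  have down: "g (Suc i) + 1 / (real (Suc i) + 1) \<le> g i + 1 / (real i + 1)" for i
  proof -
    have "ln ((real i + 1) / (real i + 2)) \<le> (real i + 1) / (real i + 2) - 1"
      by (rule ln_le_minus_one) auto
    also have "(real i + 1) / (real i + 2) - 1 = - 1 / (real i + 2)" by (simp add: field_simps)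
    also have "ln ((real i + 1) / (real i + 2)) = ln (real i + 1) - ln (real i + 2)"
      by (simp add: ln_div)
    finally show ?thesis by (simp add: g_def add.commute)
  qed
  show "g j \<le> g n" by (rule lift_Suc_mono_le[of g]) (use up assms(2) in auto)
  have "g n + 1 / (real n + 1) \<le> g j + 1 / (real j + 1)"
    by (rule lift_Suc_antimono_le[of "\<lambda>n. g n + 1 / (real n + 1)"]) (use down assms(2) in auto)
  then show "g n \<le> g j + 1 / (real j + 1)" by (smt (verit) divide_nonneg_nonneg of_nat_0_le_iff)
qed

text \<open>The derivative of \<open>x * ln x\<close> is \<open>1 + ln x\<close>, at most
  \<open>1 + ln y\<close> on an interval ending at \<open>y\<close>. The function is not monotone
  near 0, but it is nonpositive up to 1 and increasing beyond, so \<open>y \<ge> 1\<close> suffices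
  for the sign.\<close>

lemma x_ln_x_increment:
  fixes x y :: real
  assumes "0 < x" "x \<le> y" "y \<le> x + 1" "1 \<le> y"
  shows "0 \<le> y * ln y - x * ln x" "y * ln y - x * ln x \<le> 1 + ln y"
proof -
  have ly: "ln y \<ge> 0" using assms by simp
  show "0 \<le> y * ln y - x * ln x"
  proof (cases "x \<le> 1")
    case True
    then have "x * ln x \<le> 0" using assms by (simp add: mult_nonneg_nonpos)
    moreover have "y * ln y \<ge> 0" using assms ly by simp
    ultimately show ?thesis by simp
  next
    case False
    then have "x * ln x \<le> y * ln y" using assms by (intro mult_mono) auto
    then show ?thesis by simp
  qed
  have "x * ln (y / x) \<le> x * (y / x - 1)"
    using assms by (intro mult_left_mono ln_le_minus_one) auto
  also have "\<dots> = y - x" using assms by (simp add: field_simps)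
  finally have 1: "x * ln (y / x) \<le> 1" using assms by simp
  have 2: "(y - x) * ln y \<le> 1 * ln y" using assms ly by (intro mult_right_mono) auto
  have "y * ln y - x * ln x = (y - x) * ln y + x * ln (y / x)"
    using assms by (simp add: ln_div algebra_simps)
  then show "y * ln y - x * ln x \<le> 1 + ln y" using 1 2 by simp
qed

text \<open>Both quantities are combinations of \<open>h x = x * ln x\<close>: the toll at
  \<open>j + 1\<close>, \<open>k + 1\<close>, \<open>n + 1\<close>, the scaled limit toll at
  \<open>n * u\<close>, \<open>n * (1 - u)\<close>, \<open>n\<close>. Corresponding arguments differ
  by at most 1, so each increment of \<open>h\<close> costs at most
  \<open>1 + ln (n + 1)\<close>.\<close>

lemma toll_approx:
  assumes "j < n" "0 < v" "v < 1"
  shows "\<bar>toll n j - real n * Ctoll ((real j + v) / real n)\<bar> \<le> 11 + 4 * ln (real n + 1)"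
proof -
  define k where "k = n - 1 - j"
  have jk: "real j + real k = real n - 1" using assms by (simp add: k_def)
  define g where "g = (\<lambda>n. (\<Sum>k=1..n. 1 / real k) - ln (real n + 1))"
  define h where "h = (\<lambda>x::real. x * ln x)"
  define x where "x = real j + v"
  define x' where "x' = real k + 1 - v"
  have x: "0 < x" "x \<le> real j + 1" "real j + 1 \<le> x + 1"
     "0 < x'" "x' \<le> real k + 1" "real k + 1 \<le> x' + 1" "x + x' = real n"
    using assms jk by (auto simp: x_def x'_def)
  have n: "real n \<ge> 1" using assms by simp
  \<comment> \<open>The remainder from replacing harmonic numbers by logarithms. Since
    \<open>(j + 1) + (k + 1) = n + 1\<close>, the share of \<open>g n\<close> splits over the two
    subproblems, and each weighted difference lies between -1 and 0.\<close>
  define E where "E = (real j + 1) * (g j - g n) + (real k + 1) * (g k - g n)"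
  have gh: "(real i + 1) * (\<Sum>k=1..i. 1 / real k) = (real i + 1) * g i + h (real i + 1)" for i
    by (simp add: g_def h_def algebra_simps)
  have jk1: "(real j + 1) + (real k + 1) = real n + 1" using jk by simp
  have "(real j + 1) * g n + (real k + 1) * g n = (real n + 1) * g n"
    unfolding jk1[symmetric] by (simp add: algebra_simps)
  then have tl: "toll n j = real n + 3 + 2 * (h (real j + 1) + h (real k + 1) - h (real n + 1)) + 2 * E"
    using gh[of j] gh[of k] gh[of n] jk
    unfolding toll_def mu_def k_def[symmetric] E_def by (simp add: algebra_simps)
  have u: "(real j + v) / real n = x / real n" "1 - x / real n = x' / real n"
    using x n by (auto simp: x_def field_simps)
  have "real n * Ctoll ((real j + v) / real n)
        = 2 * (x * ln (x / real n)) + 2 * (x' * ln (x' / real n)) + real n"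
  proof -
    have "real n * Ctoll w = 2 * ((real n * w) * ln w) + 2 * ((real n * (1 - w)) * ln (1 - w)) + real n" for w
      by (simp add: Ctoll_def algebra_simps)
    from this[of "(real j + v) / real n"] show ?thesis
      unfolding u using n by simp
  qed
  also have "\<dots> = 2 * h x + 2 * h x' - 2 * ((x + x') * ln (real n)) + real n"
    using x(1,4) n by (simp add: h_def ln_div algebra_simps)
  finally have nC: "real n * Ctoll ((real j + v) / real n) = 2 * h x + 2 * h x' - 2 * h (real n) + real n"
    unfolding x(7) by (simp add: h_def)
  have "(real i + 1) * (g i - g n) \<le> 0" "(real i + 1) * (g i - g n) \<ge> - 1" if "i \<le> n" for i
  proof -
    note gi = harmonic_minus_ln_diff[OF that]
    show "(real i + 1) * (g i - g n) \<le> 0" using gi by (intro mult_nonneg_nonpos) (auto simp: g_def)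
    have "(real i + 1) * (g i - g n) \<ge> (real i + 1) * (- 1 / (real i + 1))"
      using gi by (intro mult_left_mono) (auto simp: g_def)
    then show "(real i + 1) * (g i - g n) \<ge> - 1" by simp
  qed
  from this[of j] this[of k] have E: "E \<le> 0" "E \<ge> -2" using assms by (auto simp: E_def k_def)
  have a: "0 \<le> h (real j + 1) - h x" "h (real j + 1) - h x \<le> 1 + ln (real j + 1)"
    using x_ln_x_increment[of x "real j + 1"] x by (auto simp: h_def)
  have b: "0 \<le> h (real k + 1) - h x'" "h (real k + 1) - h x' \<le> 1 + ln (real k + 1)"
    using x_ln_x_increment[of x' "real k + 1"] x by (auto simp: h_def)
  have c: "0 \<le> h (real n + 1) - h (real n)" "h (real n + 1) - h (real n) \<le> 1 + ln (real n + 1)"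
    using x_ln_x_increment[of "real n" "real n + 1"] n by (auto simp: h_def)
  have l: "ln (real j + 1) \<le> ln (real n + 1)" "ln (real k + 1) \<le> ln (real n + 1)" "0 \<le> ln (real n + 1)"
    using jk by auto
  have bound: "\<bar>3 + 2 * e + 2 * a + 2 * b - 2 * c\<bar> \<le> 11 + 4 * L"
    if "e \<le> 0" "- 2 \<le> e" "0 \<le> a" "a \<le> 1 + L" "0 \<le> b" "b \<le> 1 + L" "0 \<le> c" "c \<le> 1 + L" "0 \<le> L"
    for e a b c L :: real using that by linarith
  have "toll n j - real n * Ctoll ((real j + v) / real n)
     = 3 + 2 * E + 2 * (h (real j + 1) - h x) + 2 * (h (real k + 1) - h x') - 2 * (h (real n + 1) - h (real n))"
    unfolding tl nC by (simp add: algebra_simps)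
  then show ?thesis
    using bound[OF E a(1) order.trans[OF a(2)] b(1) order.trans[OF b(2)] c l(3)] l by simp
qed

text \<open>The critical recurrence admits a toll of order \<open>sqrt n\<close>, so the logarithm
  is bounded by a fourth root: \<open>ln (n + 1) = 4 * ln s \<le> 4 * s\<close> with
  \<open>s ^ 4 = n + 1\<close>, whence \<open>11 + 16 = 27\<close> and
  \<open>1458 = 2 * 27^2\<close>.\<close>

lemma toll_approx_sq:
  assumes "j < n" "0 < v" "v < 1"
  shows "(toll n j - real n * Ctoll ((real j + v) / real n))\<^sup>2 \<le> 1458 * sqrt n"
proof -
  define s where "s = sqrt (sqrt (real n + 1))"
  have s1: "s \<ge> 1" by (simp add: s_def)
  have s4: "s ^ 4 = real n + 1"
    using power_mult[of s 2 2] by (simp add: s_def)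
  have "ln (real n + 1) = 4 * ln s" unfolding s4[symmetric] using s1 by (simp add: ln_realpow)
  also have "ln s \<le> s" using ln_le_minus_one[of s] s1 by simp
  finally have "11 + 4 * ln (real n + 1) \<le> 27 * s" using s1 by simp
  with toll_approx[OF assms] have "\<bar>toll n j - real n * Ctoll ((real j + v) / real n)\<bar> \<le> 27 * s" by linarith
  then have "(toll n j - real n * Ctoll ((real j + v) / real n))\<^sup>2 \<le> (27 * s)\<^sup>2"
    using power_mono[of "\<bar>toll n j - real n * Ctoll ((real j + v) / real n)\<bar>" "27 * s" 2] by simp
  also have "\<dots> = 729 * sqrt (real n + 1)" by (simp add: s_def power_mult_distrib)
  also have "sqrt (real n + 1) \<le> sqrt (4 * real n)" using assms by (intro real_sqrt_le_mono) simp
  also have "\<dots> = 2 * sqrt n" by (simp add: real_sqrt_mult)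
  finally show ?thesis by simp
qed

lemma abs_Ctoll_le:
  assumes "0 < u" "u < 1"
  shows "\<bar>Ctoll u\<bar> \<le> 5"
proof -
  have *: "- 1 \<le> x * ln x \<and> x * ln x \<le> 0" if "0 < x" "x < 1" for x :: real
  proof
    have "ln (1 / x) \<le> 1 / x - 1" using that by (intro ln_le_minus_one) auto
    then have "x * ln (1 / x) \<le> x * (1 / x - 1)" using that by (intro mult_left_mono) auto
    then show "- 1 \<le> x * ln x" using that by (simp add: ln_div algebra_simps)
    show "x * ln x \<le> 0" using that by (simp add: mult_nonneg_nonpos)
  qed
  have "Ctoll u = 2 * (u * ln u) + 2 * ((1 - u) * ln (1 - u)) + 1" by (simp add: Ctoll_def)
  then show ?thesis using *[of u] *[of "1 - u"] assms by linarith
qed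

lemma toll_sq_le:
  assumes "j < n"
  shows "(toll n j)\<^sup>2 \<le> 3000 * (real n)\<^sup>2"
proof -
  \<comment> \<open>The value \<open>v = 1/2\<close> is an arbitrary point of the cell. The bound
    follows from \<open>2 * 1458 + 2 * 25 \<le> 3000\<close>.\<close>
  define c where "c = toll n j - real n * Ctoll ((real j + 1/2) / real n)"
  have n: "real n \<ge> 1" using assms by simp
  have "real j + 1 \<le> real n" using assms by simp
  then have "\<bar>Ctoll ((real j + 1/2) / real n)\<bar> \<le> 5"
    by (intro abs_Ctoll_le) (auto simp: field_simps n)
  then have "(real n * Ctoll ((real j + 1/2) / real n))\<^sup>2 \<le> (real n * 5)\<^sup>2"
    by (intro power2_le_iff_abs_le[THEN iffD2]) (auto simp: abs_mult intro!: mult_left_mono)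
  moreover have "c\<^sup>2 \<le> 1458 * sqrt n" unfolding c_def by (rule toll_approx_sq[OF assms]) auto
  moreover have "sqrt n \<le> (real n)\<^sup>2"
  proof -
    have "sqrt n \<le> sqrt n ^ 4" using n by (intro self_le_power) auto
    also have "\<dots> = (real n)\<^sup>2" using power_mult[of "sqrt n" 2 2] by simp
    finally show ?thesis .
  qed
  moreover have "(toll n j)\<^sup>2 \<le> 2 * c\<^sup>2 + 2 * (real n * Ctoll ((real j + 1/2) / real n))\<^sup>2"
  proof -
    have "(a + b)\<^sup>2 \<le> 2 * a\<^sup>2 + 2 * b\<^sup>2" for a b :: real
      using zero_le_power2[of "a - b"] by (simp add: power2_eq_square algebra_simps)
    from this[of c "real n * Ctoll ((real j + 1/2) / real n)"] show ?thesis by (simp add: c_def)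
  qed
  moreover have "(real n * 5)\<^sup>2 = 25 * (real n)\<^sup>2" by simp
  moreover have "0 \<le> (real n)\<^sup>2" by simp
  ultimately show ?thesis by linarith
qed

section \<open>The law of the number of comparisons\<close>

abbreviation U01 :: "real measure" where
  "U01 \<equiv> uniform_measure lborel {0<..<1}"

lemma prob_space_U01: "prob_space U01"
  by (rule prob_space_uniform_measure) auto

text \<open>The null point 0 is added because half-open intervals tile without overlap.\<close>

lemma nn_integral_U01:
  assumes [measurable]: "f \<in> borel_measurable borel"
  shows "(\<integral>\<^sup>+u. f u \<partial>U01) = (\<integral>\<^sup>+u. f u * indicator {0..<1} u \<partial>lborel)"
proof -
  have "(\<integral>\<^sup>+u. f u \<partial>U01) = (\<integral>\<^sup>+u. f u * indicator {0<..<1} u \<partial>lborel)"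
    by (subst nn_integral_uniform_measure) (auto simp: divide_ennreal_def)
  also have "\<dots> = (\<integral>\<^sup>+u. f u * indicator {0..<1} u \<partial>lborel)"
    by (intro nn_integral_cong_AE eventually_mono[OF AE_lborel_singleton[of 0]]) (auto simp: indicator_def)
  finally show ?thesis .
qed

text \<open>If \<open>j\<close> is uniform on \<open>{..<n}\<close> and \<open>v\<close> is
  independent and uniform on the unit interval, then \<open>(j + v) / n\<close> is uniform: each
  cell of length \<open>1 / n\<close> is an affine image of the unit interval. This allows a
  discrete pivot rank to drive the continuous split point.\<close>

lemma nn_integral_U01_subdivide:
  assumes [measurable]: "f \<in> borel_measurable borel" and n: "n > 0"
  shows "(\<Sum>j<n. \<integral>\<^sup>+v. f ((real j + v) / real n) \<partial>U01) / of_nat n = (\<integral>\<^sup>+u. f u \<partial>U01)"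
proof -
  define I where "I = (\<lambda>j. {real j / real n ..< real (Suc j) / real n})"
  have piece: "(\<integral>\<^sup>+v. f ((real j + v) / real n) \<partial>U01) = of_nat n * (\<integral>\<^sup>+u. f u * indicator (I j) u \<partial>lborel)" for j
  proof -
    have ind: "indicator (I j) (real j / real n + 1 / real n * v) = (indicator {0..<1} v :: ennreal)" for v
      using n by (auto simp: I_def indicator_def field_simps)
    have "(\<integral>\<^sup>+u. f u * indicator (I j) u \<partial>lborel)
       = ennreal \<bar>1 / real n\<bar> * (\<integral>\<^sup>+v. f (real j / real n + 1 / real n * v) * indicator (I j) (real j / real n + 1 / real n * v) \<partial>lborel)"
      using n by (intro nn_integral_real_affine) (auto simp: I_def)
    also have "\<dots> = ennreal (1 / real n) * (\<integral>\<^sup>+v. f ((real j + v) / real n) \<partial>U01)"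
      unfolding ind by (subst nn_integral_U01) (auto simp: add_divide_distrib)
    finally have "of_nat n * (\<integral>\<^sup>+u. f u * indicator (I j) u \<partial>lborel)
        = (of_nat n * ennreal (1 / real n)) * (\<integral>\<^sup>+v. f ((real j + v) / real n) \<partial>U01)"
      by (simp add: mult.assoc)
    also have "of_nat n * ennreal (1 / real n) = 1"
      using n by (simp add: ennreal_of_nat_eq_real_of_nat flip: ennreal_mult)
    finally show ?thesis by simp
  qed
  have tile: "(\<Sum>j<m. indicator (I j) u) = (indicator {0..<real m / real n} u :: ennreal)" for m u
  proof (induction m)
    case (Suc m)
    have "real m / real n \<le> real (Suc m) / real n" by (intro divide_right_mono) auto
    moreover have "0 \<le> u" if "real m / real n \<le> u"
      using that by (rule order.trans[rotated]) simp
    ultimately show ?case using Suc by (auto simp: I_def indicator_def)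
  qed simp
  have "(\<Sum>j<n. \<integral>\<^sup>+v. f ((real j + v) / real n) \<partial>U01)
      = of_nat n * (\<Sum>j<n. \<integral>\<^sup>+u. f u * indicator (I j) u \<partial>lborel)"
    by (simp add: piece sum_distrib_left)
  also have "(\<Sum>j<n. \<integral>\<^sup>+u. f u * indicator (I j) u \<partial>lborel) = (\<integral>\<^sup>+u. (\<Sum>j<n. f u * indicator (I j) u) \<partial>lborel)"
    by (subst nn_integral_sum) (auto simp: I_def)
  also have "\<dots> = (\<integral>\<^sup>+u. f u \<partial>U01)"
    using n by (simp add: nn_integral_U01 tile flip: sum_distrib_left)
  finally show ?thesis
    using n by (simp add: mult.commute[of "of_nat n"] ennreal_mult_divide_eq)
qed

lemma nn_integral_triple:
  assumes "prob_space P" "prob_space Q" and f: "f \<in> borel_measurable (R \<Otimes>\<^sub>M (P \<Otimes>\<^sub>M Q))"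
  shows "(\<integral>\<^sup>+x. f x \<partial>(R \<Otimes>\<^sub>M (P \<Otimes>\<^sub>M Q))) = (\<integral>\<^sup>+v. \<integral>\<^sup>+z. \<integral>\<^sup>+z'. f (v, z, z') \<partial>Q \<partial>P \<partial>R)"
proof -
  interpret P: prob_space P by fact
  interpret Q: prob_space Q by fact
  interpret PQ: pair_prob_space P Q ..
  have "(\<integral>\<^sup>+x. f x \<partial>(R \<Otimes>\<^sub>M (P \<Otimes>\<^sub>M Q))) = (\<integral>\<^sup>+v. \<integral>\<^sup>+zz. f (v, zz) \<partial>(P \<Otimes>\<^sub>M Q) \<partial>R)"
    by (rule PQ.nn_integral_fst[OF f, symmetric])
  also have "\<dots> = (\<integral>\<^sup>+v. \<integral>\<^sup>+z. \<integral>\<^sup>+z'. f (v, z, z') \<partial>Q \<partial>P \<partial>R)"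
  proof (intro nn_integral_cong Q.nn_integral_fst[symmetric])
    fix v assume "v \<in> space R"
    then show "(\<lambda>zz. f (v, zz)) \<in> borel_measurable (P \<Otimes>\<^sub>M Q)"
      using f by (rule measurable_compose[OF measurable_Pair1'])
  qed
  finally show ?thesis .
qed

section \<open>The distributional recursion\<close>

lemma qs_laws_nth:
  "length (qs_laws n) = n" "j < n \<Longrightarrow> qs_laws n ! j = X_law j"
proof -
  have len: "length (qs_laws n) = n" for n by (induction n) auto
  show "length (qs_laws n) = n" by (rule len)
  have "qs_laws (Suc j + i) ! j = X_law j" for i
  proof (induction i)
    case 0
    show ?case by (simp only: X_law_def add_0_right)
  next
    case (Suc i)
    have "qs_laws (Suc j + Suc i) ! j = qs_laws (Suc j + i) ! j"
      unfolding add_Suc_right qs_laws.simps(2)[of "Suc j + i"] nth_append len by simp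
    then show ?case using Suc.IH by (simp only:)
  qed
  from this[of "n - Suc j"] show "j < n \<Longrightarrow> qs_laws n ! j = X_law j" by simp
qed

lemma X_law_0: "X_law 0 = return_pmf 0"
  by (simp add: X_law_def qs_step_def)

text \<open>The pivot rank is shifted down by one, so that \<open>j\<close> is the size of the left
  subproblem.\<close>

lemma X_law_rec:
  assumes "n \<ge> 1"
  shows "X_law n = bind_pmf (pmf_of_set {..<n}) (\<lambda>j. bind_pmf (X_law j) (\<lambda>a.
    bind_pmf (X_law (n - 1 - j)) (\<lambda>b. return_pmf (a + b + n - 1))))"
proof -
  have e: "pmf_of_set {1..n} = map_pmf Suc (pmf_of_set {..<n})"
    using assms by (subst map_pmf_of_set_inj) (auto simp: image_Suc_lessThan lessThan_empty_iff)
  have "qs_laws n \<noteq> []" using qs_laws_nth(1)[of n] assms by auto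
  then have "X_law n = bind_pmf (pmf_of_set {1..n}) (\<lambda>u.
       bind_pmf (qs_laws n ! (u - 1)) (\<lambda>a.
         bind_pmf (qs_laws n ! (n - u)) (\<lambda>b.
           return_pmf (a + b + n - 1))))"
    by (simp add: X_law_def nth_append qs_laws_nth(1) qs_step_def)
  also have "\<dots> = bind_pmf (pmf_of_set {..<n}) (\<lambda>j.
       bind_pmf (qs_laws n ! j) (\<lambda>a.
         bind_pmf (qs_laws n ! (n - Suc j)) (\<lambda>b.
           return_pmf (a + b + n - 1))))"
    unfolding e by (simp add: bind_map_pmf)
  also have "\<dots> = bind_pmf (pmf_of_set {..<n}) (\<lambda>j. bind_pmf (X_law j) (\<lambda>a.
    bind_pmf (X_law (n - 1 - j)) (\<lambda>b. return_pmf (a + b + n - 1))))"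
    using assms by (intro bind_pmf_cong) (auto simp: qs_laws_nth set_pmf_of_set lessThan_empty_iff)
  finally show ?thesis .
qed

lemma finite_set_X_law: "finite (set_pmf (X_law n))"
proof (induction n rule: less_induct)
  case (less n)
  show ?case
  proof (cases "n = 0")
    case False
    then have "n \<ge> 1" "{..<n} \<noteq> {}" by (auto simp: lessThan_empty_iff)
    then show ?thesis
      unfolding X_law_rec[OF \<open>n \<ge> 1\<close>] by (auto simp: set_bind_pmf set_pmf_of_set intro!: finite_UN_I less)
  qed (simp add: X_law_0)
qed

lemma expectation_bind_finite_pmf:
  fixes h :: "'b \<Rightarrow> real"
  assumes "finite (set_pmf p)" "\<And>x. x \<in> set_pmf p \<Longrightarrow> finite (set_pmf (f x))"
  shows "measure_pmf.expectation (bind_pmf p f) h = measure_pmf.expectation p (\<lambda>x. measure_pmf.expectation (f x) h)"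
  using assms pmf_expectation_bind[of "set_pmf p" f p h]
    integral_measure_pmf[of "set_pmf p" p "\<lambda>x. measure_pmf.expectation (f x) h"]
  by (simp add: set_pmf_iff)

lemma nn_integral_X_law_rec:
  assumes "n \<ge> 1"
  shows "(\<integral>\<^sup>+k. f k \<partial>X_law n)
    = (\<Sum>j<n. \<integral>\<^sup>+a. \<integral>\<^sup>+b. f (a + b + n - 1) \<partial>X_law (n - 1 - j) \<partial>X_law j) / of_nat n"
proof -
  have ne: "{..<n} \<noteq> {}" using assms by (auto simp: lessThan_empty_iff)
  show ?thesis
    unfolding X_law_rec[OF assms] nn_integral_bind_pmf nn_integral_pmf_of_set[OF ne finite_lessThan]
      card_lessThan by (simp only: nn_integral_return_pmf zero_le)
qed

lemma expectation_X_law: "measure_pmf.expectation (X_law n) real = mu n"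
proof (induction n rule: less_induct)
  case (less n)
  show ?case
  proof (cases "n = 0")
    case True
    then show ?thesis by (simp add: X_law_0 mu_def)
  next
    case False
    have int [simp]: "integrable (X_law j) f" for j and f :: "nat \<Rightarrow> real"
      by (intro integrable_measure_pmf_finite finite_set_X_law)
    have "measure_pmf.expectation (X_law n) real = (\<Sum>j<n. measure_pmf.expectation (X_law j) (\<lambda>a.
       measure_pmf.expectation (X_law (n - 1 - j)) (\<lambda>b. real (a + b + n - 1)))) / real n"
    proof -
      have n: "n \<ge> 1" "{..<n} \<noteq> {}" using False by (auto simp: lessThan_empty_iff)
      show ?thesis
        unfolding X_law_rec[OF n(1)]
        by (subst pmf_expectation_bind_pmf_of_set)
           (auto simp: n expectation_bind_finite_pmf finite_set_X_law sum_distrib_left sum_divide_distrib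
             divide_inverse mult.commute intro!: finite_UN_I)
    qed
    also have "\<dots> = (\<Sum>j<n. mu j + mu (n - 1 - j) + (real n - 1)) / real n"
    proof (intro arg_cong2[of _ _ _ _ "(/)"] sum.cong refl)
      fix j assume "j \<in> {..<n}"
      then have ih: "measure_pmf.expectation (X_law j) real = mu j"
          "measure_pmf.expectation (X_law (n - 1 - j)) real = mu (n - 1 - j)"
        by (auto intro!: less)
      have e: "real (a + b + n - 1) = real a + real b + (real n - 1)" for a b
        using False by simp
      show "measure_pmf.expectation (X_law j) (\<lambda>a.
          measure_pmf.expectation (X_law (n - 1 - j)) (\<lambda>b. real (a + b + n - 1)))
          = mu j + mu (n - 1 - j) + (real n - 1)"
        unfolding e using ih by simp
    qed
    also have "\<dots> = (\<Sum>j<n. toll n j + mu n) / real n" by (simp add: toll_def algebra_simps)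
    also have "\<dots> = mu n" using False sum_toll[of n] by (simp add: sum.distrib)
    finally show ?thesis .
  qed
qed

section \<open>Moments of independent sums\<close>

lemma nn_integral_le_integral:
  fixes h R :: "'a \<Rightarrow> real"
  assumes "integrable M R" "\<And>x. 0 \<le> h x" "\<And>x. h x \<le> R x"
  shows "(\<integral>\<^sup>+x. ennreal (h x) \<partial>M) \<le> ennreal (\<integral>x. R x \<partial>M)"
proof -
  have "(\<integral>\<^sup>+x. ennreal (h x) \<partial>M) \<le> (\<integral>\<^sup>+x. ennreal (R x) \<partial>M)"
    using assms(3) by (intro nn_integral_mono ennreal_leI) auto
  also have "\<dots> = ennreal (\<integral>x. R x \<partial>M)"
    using assms order.trans[OF assms(2,3)] by (intro nn_integral_eq_integral) auto
  finally show ?thesis .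
qed

text \<open>All cross terms have mean zero, so the two second moments enter with coefficient exactly
  1, as the critical recurrence demands.\<close>

lemma second_moment_independent_sum:
  fixes f :: "'a \<Rightarrow> real" and g :: "'b \<Rightarrow> real"
  assumes "prob_space P" "prob_space Q"
    and f: "integrable P f" "integrable P (\<lambda>x. (f x)\<^sup>2)" "(\<integral>x. f x \<partial>P) = 0"
    and g: "integrable Q g" "integrable Q (\<lambda>x. (g x)\<^sup>2)" "(\<integral>x. g x \<partial>Q) = 0"
  shows "(\<integral>\<^sup>+x. \<integral>\<^sup>+y. ennreal ((f x + g y + c)\<^sup>2) \<partial>Q \<partial>P)
    \<le> ennreal ((\<integral>x. (f x)\<^sup>2 \<partial>P) + (\<integral>y. (g y)\<^sup>2 \<partial>Q) + c\<^sup>2)"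
proof -
  interpret P: prob_space P by fact
  interpret Q: prob_space Q by fact
  have "(\<integral>\<^sup>+y. ennreal ((s + g y + c)\<^sup>2) \<partial>Q) \<le> ennreal ((s + c)\<^sup>2 + (\<integral>y. (g y)\<^sup>2 \<partial>Q))" for s
  proof -
    have "(\<integral>\<^sup>+y. ennreal ((s + g y + c)\<^sup>2) \<partial>Q) \<le> ennreal (\<integral>y. (s + c)\<^sup>2 + (g y)\<^sup>2 + 2 * (s + c) * g y \<partial>Q)"
      using g by (intro nn_integral_le_integral zero_le_power2 add_nonneg_nonneg integral_nonneg_AE AE_I2) (auto simp: power2_eq_square algebra_simps)
    then show ?thesis using g by (simp add: Q.prob_space)
  qed
  then have "(\<integral>\<^sup>+x. \<integral>\<^sup>+y. ennreal ((f x + g y + c)\<^sup>2) \<partial>Q \<partial>P)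
    \<le> (\<integral>\<^sup>+x. ennreal ((f x + c)\<^sup>2 + (\<integral>y. (g y)\<^sup>2 \<partial>Q)) \<partial>P)"
    by (intro nn_integral_mono) auto
  also have "\<dots> \<le> ennreal (\<integral>x. (f x)\<^sup>2 + c\<^sup>2 + 2 * c * f x + (\<integral>y. (g y)\<^sup>2 \<partial>Q) \<partial>P)"
    using f by (intro nn_integral_le_integral zero_le_power2 add_nonneg_nonneg integral_nonneg_AE AE_I2) (auto simp: power2_eq_square algebra_simps)
  finally show ?thesis using f by (simp add: P.prob_space add_ac)
qed

text \<open>The terms of \<open>even_power_binomial_le\<close> that are linear in one variable
  integrate to zero, and independence factors the others into products of lower moments. The
  constant \<open>K\<close> is fixed before the measures and functions, so that one value serves
  every step of the recursion.\<close>

lemma even_moment_independent_sum: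
  fixes m :: nat
  assumes m: "m \<ge> 2"
  obtains K :: real where "K \<ge> 0"
    "\<And>(P :: 'a measure) (Q :: 'b measure) f g c.
       prob_space P \<Longrightarrow> prob_space Q \<Longrightarrow>
       (\<And>i. integrable P (\<lambda>x. f x ^ i)) \<Longrightarrow> (\<And>i. integrable Q (\<lambda>y. g y ^ i)) \<Longrightarrow>
       (\<integral>x. f x \<partial>P) = 0 \<Longrightarrow> (\<integral>y. g y \<partial>Q) = 0 \<Longrightarrow>
       (\<integral>\<^sup>+x. \<integral>\<^sup>+y. ennreal ((f x + g y + c) ^ (2*m)) \<partial>Q \<partial>P)
       \<le> ennreal (9/8 * ((\<integral>x. f x ^ (2*m) \<partial>P) + (\<integral>y. g y ^ (2*m) \<partial>Q))
          + K * ((\<integral>x. f x ^ (2*(m-1)) \<partial>P) * (\<integral>y. g y ^ 2 \<partial>Q)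
               + (\<integral>x. f x ^ 2 \<partial>P) * (\<integral>y. g y ^ (2*(m-1)) \<partial>Q) + c ^ (2*m)))"
proof -
  obtain K1 :: real where K1: "K1 \<ge> 0" "\<And>x c :: real. (x + c) ^ (2*m) \<le> 9/8 * x ^ (2*m) + K1 * c ^ (2*m)"
    using even_power_add_le[of m] by blast
  define K where "K = 9/8 * 4 ^ m + K1"
  have ev: "0 \<le> t ^ (2*l)" for t :: real and l by (simp add: power_mult)
  have pw: "(x + y + c) ^ (2*m) \<le> 9/8 * (x ^ (2*m) + y ^ (2*m) + 2 * real m * (x ^ (2*m-1) * y + x * y ^ (2*m-1)))
       + K * (x ^ (2*(m-1)) * y ^ 2 + x ^ 2 * y ^ (2*(m-1)) + c ^ (2*m))" for x y c :: real
  proof -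
    define S where "S = x ^ (2*(m-1)) * y ^ 2 + x ^ 2 * y ^ (2*(m-1))"
    have S: "S \<ge> 0" unfolding S_def by (intro add_nonneg_nonneg mult_nonneg_nonneg ev) auto
    have "9/8 * 4 ^ m * S + K1 * c ^ (2*m) \<le> K * S + K * c ^ (2*m)"
      using S K1(1) ev[of c m] unfolding K_def by (intro add_mono mult_right_mono) auto
    moreover define T where "T = x ^ (2*m) + y ^ (2*m) + 2 * real m * (x ^ (2*m-1) * y + x * y ^ (2*m-1))"
    moreover have "9/8 * (x + y) ^ (2*m) \<le> 9/8 * (T + 4 ^ m * S)"
      using even_power_binomial_le[OF m, of x y] unfolding T_def S_def by (intro mult_left_mono) auto
    ultimately show ?thesis
      using K1(2)[of "x + y" c] unfolding S_def[symmetric] T_def[symmetric]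
      by (simp only: distrib_left mult.assoc)
  qed
  show ?thesis
  proof (rule that)
    show "K \<ge> 0" using K1 by (simp add: K_def)
    fix P :: "'a measure" and Q :: "'b measure" and f :: "'a \<Rightarrow> real" and g :: "'b \<Rightarrow> real" and c :: real
    assume "prob_space P" "prob_space Q" and f: "\<And>i. integrable P (\<lambda>x. f x ^ i)" and g: "\<And>i. integrable Q (\<lambda>y. g y ^ i)"
      and f0: "(\<integral>x. f x \<partial>P) = 0" and g0: "(\<integral>y. g y \<partial>Q) = 0"
    interpret P: prob_space P by fact
    interpret Q: prob_space Q by fact
    have f1: "integrable P f" and g1: "integrable Q g" using f[of 1] g[of 1] by simp_all
    define G where "G = (\<lambda>i. \<integral>y. g y ^ i \<partial>Q)"
    \<comment> \<open>The majorant integrated over the second variable. The term linear in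
      \<open>g\<close> is already gone; \<open>x * G (2*m-1)\<close> vanishes only under the outer
      integral, where \<open>x\<close> becomes the centred \<open>f\<close>.\<close>
    define R where "R = (\<lambda>x. 9/8 * (x ^ (2*m) + G (2*m) + 2 * real m * (x * G (2*m-1)))
       + K * (x ^ (2*(m-1)) * G 2 + x ^ 2 * G (2*(m-1)) + c ^ (2*m)))"
    have R: "R x = (\<integral>y. 9/8 * (x ^ (2*m) + g y ^ (2*m) + 2 * real m * (x ^ (2*m-1) * g y + x * g y ^ (2*m-1)))
       + K * (x ^ (2*(m-1)) * g y ^ 2 + x ^ 2 * g y ^ (2*(m-1)) + c ^ (2*m)) \<partial>Q)" for x
      using g g1 g0 by (simp add: R_def G_def Q.prob_space)
    have R0: "0 \<le> R x" for x
      unfolding R by (intro integral_nonneg_AE AE_I2 order.trans[OF ev pw])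
    have inner: "(\<integral>\<^sup>+y. ennreal ((x + g y + c) ^ (2*m)) \<partial>Q) \<le> ennreal (R x)" for x
      unfolding R using g g1 by (intro nn_integral_le_integral pw ev) auto
    have "(\<integral>\<^sup>+x. \<integral>\<^sup>+y. ennreal ((f x + g y + c) ^ (2*m)) \<partial>Q \<partial>P) \<le> (\<integral>\<^sup>+x. ennreal (R (f x)) \<partial>P)"
      by (intro nn_integral_mono inner)
    also have "\<dots> \<le> ennreal (\<integral>x. R (f x) \<partial>P)"
      using R0 f f1 by (intro nn_integral_le_integral) (auto simp: R_def)
    also have "(\<integral>x. R (f x) \<partial>P) = 9/8 * ((\<integral>x. f x ^ (2*m) \<partial>P) + (\<integral>y. g y ^ (2*m) \<partial>Q))
          + K * ((\<integral>x. f x ^ (2*(m-1)) \<partial>P) * (\<integral>y. g y ^ 2 \<partial>Q)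
               + (\<integral>x. f x ^ 2 \<partial>P) * (\<integral>y. g y ^ (2*(m-1)) \<partial>Q) + c ^ (2*m))"
      using f f1 f0 by (simp add: R_def G_def P.prob_space)
    finally show "(\<integral>\<^sup>+x. \<integral>\<^sup>+y. ennreal ((f x + g y + c) ^ (2*m)) \<partial>Q \<partial>P)
       \<le> ennreal (9/8 * ((\<integral>x. f x ^ (2*m) \<partial>P) + (\<integral>y. g y ^ (2*m) \<partial>Q))
          + K * ((\<integral>x. f x ^ (2*(m-1)) \<partial>P) * (\<integral>y. g y ^ 2 \<partial>Q)
               + (\<integral>x. f x ^ 2 \<partial>P) * (\<integral>y. g y ^ (2*(m-1)) \<partial>Q) + c ^ (2*m)))" .
  qed
qed

section \<open>The recursive coupling\<close>

text \<open>One recursion step of the count and one step of the fixed point equation, driven by the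
  same \<open>j\<close> and \<open>v\<close>; \<open>(j + v) / n\<close> plays the role of
  \<open>U\<close>.\<close>

definition combine :: "nat \<Rightarrow> nat \<Rightarrow> real \<Rightarrow> real \<times> real \<Rightarrow> real \<times> real \<Rightarrow> real \<times> real" where
  "combine n j v z z' = (fst z + fst z' + toll n j,
     (real j + v) / real n * snd z + (1 - (real j + v) / real n) * snd z' + Ctoll ((real j + v) / real n))"

definition merge_couplings :: "nat \<Rightarrow> nat \<Rightarrow> (real \<times> real) measure \<Rightarrow> (real \<times> real) measure \<Rightarrow> (real \<times> real) measure" where
  "merge_couplings n j P Q = distr (U01 \<Otimes>\<^sub>M (P \<Otimes>\<^sub>M Q)) borel (\<lambda>(v, z, z'). combine n j v z z')"

lemma measurable_combine:
  assumes "sets P = sets borel" "sets Q = sets borel"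
  shows "(\<lambda>(v, z, z'). combine n j v z z') \<in> U01 \<Otimes>\<^sub>M (P \<Otimes>\<^sub>M Q) \<rightarrow>\<^sub>M borel"
proof -
  have "(\<lambda>(v, z, z'). combine n j v z z') \<in> borel \<Otimes>\<^sub>M ((borel \<Otimes>\<^sub>M borel) \<Otimes>\<^sub>M (borel \<Otimes>\<^sub>M borel)) \<rightarrow>\<^sub>M borel"
    unfolding combine_def Ctoll_def borel_prod[symmetric, where 'a=real and 'b=real] by measurable
  moreover have eq: "sets (U01 \<Otimes>\<^sub>M (P \<Otimes>\<^sub>M Q)) = sets (borel \<Otimes>\<^sub>M ((borel \<Otimes>\<^sub>M borel) \<Otimes>\<^sub>M (borel \<Otimes>\<^sub>M borel)))"
    using assms unfolding borel_prod[where 'a=real and 'b=real] by (intro sets_pair_measure_cong) simp_all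
  ultimately show ?thesis by (subst measurable_cong_sets[OF eq refl])
qed

lemma sets_merge_couplings [simp]: "sets (merge_couplings n j P Q) = sets borel"
  by (simp add: merge_couplings_def)

lemma prob_space_merge_couplings:
  assumes "prob_space P" "sets P = sets borel" "prob_space Q" "sets Q = sets borel"
  shows "prob_space (merge_couplings n j P Q)"
proof -
  interpret P: prob_space P by fact
  interpret Q: prob_space Q by fact
  interpret PQ: pair_prob_space P Q ..
  interpret U: prob_space U01 by (rule prob_space_U01)
  interpret U: pair_prob_space U01 "P \<Otimes>\<^sub>M Q" ..
  show ?thesis unfolding merge_couplings_def
    by (intro U.prob_space_distr measurable_combine assms)
qed

lemma nn_integral_merge_couplings:
  assumes PQ: "prob_space P" "sets P = sets borel" "prob_space Q" "sets Q = sets borel"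
    and f: "f \<in> borel_measurable borel"
  shows "(\<integral>\<^sup>+z. f z \<partial>merge_couplings n j P Q) = (\<integral>\<^sup>+v. \<integral>\<^sup>+z. \<integral>\<^sup>+z'. f (combine n j v z z') \<partial>Q \<partial>P \<partial>U01)"
proof -
  note m = measurable_combine[OF PQ(2,4), of n j]
  have "(\<integral>\<^sup>+z. f z \<partial>merge_couplings n j P Q)
      = (\<integral>\<^sup>+x. f ((\<lambda>(v, z, z'). combine n j v z z') x) \<partial>(U01 \<Otimes>\<^sub>M (P \<Otimes>\<^sub>M Q)))"
    unfolding merge_couplings_def using m f by (intro nn_integral_distr) auto
  also have "\<dots> = (\<integral>\<^sup>+v. \<integral>\<^sup>+z. \<integral>\<^sup>+z'. f (combine n j v z z') \<partial>Q \<partial>P \<partial>U01)"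
    using measurable_compose[OF m f] by (subst nn_integral_triple) (use PQ in auto)
  finally show ?thesis .
qed

locale quicksort_fixpoint = real_distribution Y for Y :: "real measure" +
  assumes mean_zero: "(\<integral>y. y \<partial>Y) = 0"
    and fixpoint: "Y = distr (U01 \<Otimes>\<^sub>M (Y \<Otimes>\<^sub>M Y)) borel (\<lambda>(u, y, y'). u * y + (1 - u) * y' + Ctoll u)"
begin

text \<open>The pivot rank \<open>j\<close> and the limiting split point \<open>u\<close> are coupled as \<open>u = (j + v) / n\<close> with \<open>v\<close> uniform,
  so that \<open>u\<close> is uniform on \<open>(0, 1)\<close> and within \<open>1 / n\<close> of \<open>j / n\<close>.
  The first component is \<open>X\<^sub>n - mu n\<close>, the second has law \<open>Y\<close>.\<close>
fun cpl :: "nat \<Rightarrow> (real \<times> real) measure" where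
  "cpl n = (if n = 0 then distr Y borel (\<lambda>y. (0, y))
     else measure_pmf (pmf_of_set {..<n}) \<bind> (\<lambda>j.
       if j < n then merge_couplings n j (cpl j) (cpl (n - 1 - j)) else return borel (0, 0)))"

declare cpl.simps [simp del]

lemma cpl_0: "cpl 0 = distr Y borel (\<lambda>y. (0, y))"
  by (simp add: cpl.simps)

text \<open>The test \<open>j < n\<close> in \<open>cpl\<close> makes the recursive calls decrease.
  Its default value is a probability measure, so the kernel is well formed for every
  \<open>j\<close>, and the uniform choice on \<open>{..<n}\<close> never reaches it when
  \<open>n > 0\<close>.\<close>

lemma cpl_kernel:
  assumes "\<And>j. j < n \<Longrightarrow> prob_space (cpl j) \<and> sets (cpl j) = sets borel"
  shows "(\<lambda>j. if j < n then merge_couplings n j (cpl j) (cpl (n - 1 - j)) else return borel (0, 0))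
    \<in> measure_pmf (pmf_of_set {..<n}) \<rightarrow>\<^sub>M prob_algebra borel"
proof -
  have "prob_space (merge_couplings n j (cpl j) (cpl (n - 1 - j)))" if "j < n" for j
    using assms[of j] assms[of "n - 1 - j"] that by (intro prob_space_merge_couplings) auto
  then show ?thesis
    by (auto simp: measurable_pmf_measure1 space_prob_algebra intro!: prob_space_return split: if_splits)
qed

lemma cpl_wf: "prob_space (cpl n) \<and> sets (cpl n) = sets borel"
proof (induction n rule: less_induct)
  case (less n)
  show ?case
  proof (cases "n = 0")
    case True
    then show ?thesis by (auto simp: cpl_0 intro!: prob_space_distr borel_measurable_Pair)
  next
    case False
    note k = cpl_kernel[OF less]
    have s: "measure_pmf (pmf_of_set {..<n}) \<in> space (prob_algebra (measure_pmf (pmf_of_set {..<n})))"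
      by (auto simp: space_prob_algebra prob_space_measure_pmf)
    show ?thesis using False prob_space_bind'[OF s k] sets_bind'[OF s k]
      by (subst (1 2) cpl.simps) auto
  qed
qed

lemma prob_space_cpl: "prob_space (cpl n)" and sets_cpl [measurable_cong, simp]: "sets (cpl n) = sets borel"
  using cpl_wf by auto

lemma space_cpl [simp]: "space (cpl n) = UNIV"
  using sets_eq_imp_space_eq[OF sets_cpl[of n]] by simp

lemma nn_integral_cpl:
  assumes n: "n \<ge> 1" and f: "f \<in> borel_measurable borel"
  shows "(\<integral>\<^sup>+z. f z \<partial>cpl n)
    = (\<Sum>j<n. \<integral>\<^sup>+v. \<integral>\<^sup>+z. \<integral>\<^sup>+z'. f (combine n j v z z') \<partial>cpl (n - 1 - j) \<partial>cpl j \<partial>U01) / of_nat n"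
proof -
  have ne: "{..<n} \<noteq> {}" using n by (auto simp: lessThan_empty_iff)
  have k: "(\<lambda>j. if j < n then merge_couplings n j (cpl j) (cpl (n - 1 - j)) else return borel (0, 0))
    \<in> measure_pmf (pmf_of_set {..<n}) \<rightarrow>\<^sub>M subprob_algebra borel"
    by (intro measurable_prob_algebraD cpl_kernel cpl_wf)
  have "(\<integral>\<^sup>+z. f z \<partial>cpl n) = (\<integral>\<^sup>+j. \<integral>\<^sup>+z. f z \<partial>(if j < n then merge_couplings n j (cpl j) (cpl (n - 1 - j)) else return borel (0, 0)) \<partial>pmf_of_set {..<n})"
    using n by (subst cpl.simps) (simp add: nn_integral_bind[OF f k])
  also have "\<dots> = (\<Sum>j<n. \<integral>\<^sup>+z. f z \<partial>merge_couplings n j (cpl j) (cpl (n - 1 - j))) / of_nat n"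
    by (subst nn_integral_pmf_of_set[OF ne]) auto
  also have "(\<Sum>j<n. \<integral>\<^sup>+z. f z \<partial>merge_couplings n j (cpl j) (cpl (n - 1 - j)))
     = (\<Sum>j<n. \<integral>\<^sup>+v. \<integral>\<^sup>+z. \<integral>\<^sup>+z'. f (combine n j v z z') \<partial>cpl (n - 1 - j) \<partial>cpl j \<partial>U01)"
    by (intro sum.cong refl nn_integral_merge_couplings prob_space_cpl sets_cpl f)
  finally show ?thesis .
qed

text \<open>The marginal is expressed through arbitrary nonnegative test functions, because the
  induction hypothesis for \<open>j\<close> is applied to a test function that is itself an integral
  over the other subproblem. The first coordinate ignores \<open>v\<close>, so the uniform variable
  integrates out.\<close>

lemma nn_integral_cpl_fst:
  assumes "f \<in> borel_measurable borel"
  shows "(\<integral>\<^sup>+z. f (fst z) \<partial>cpl n) = (\<integral>\<^sup>+k. f (real k - mu n) \<partial>X_law n)"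
  using assms
proof (induction n arbitrary: f rule: less_induct)
  case (less n)
  note [measurable] = less.prems
  show ?case
  proof (cases "n = 0")
    case True
    have "(\<integral>\<^sup>+z. f (fst z) \<partial>cpl 0) = (\<integral>\<^sup>+y. f 0 \<partial>Y)"
      unfolding cpl_0 by (subst nn_integral_distr) (auto intro!: borel_measurable_Pair simp: borel_prod[symmetric])
    then show ?thesis using True emeasure_space_1 by (simp add: X_law_0 mu_def)
  next
    case False
    have "(\<integral>\<^sup>+z. f (fst z) \<partial>cpl n)
      = (\<Sum>j<n. \<integral>\<^sup>+v. \<integral>\<^sup>+z. \<integral>\<^sup>+z'. f (fst z + fst z' + toll n j) \<partial>cpl (n - 1 - j) \<partial>cpl j \<partial>U01) / of_nat n"
      using False by (subst nn_integral_cpl) (auto simp: combine_def borel_prod[symmetric])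
    also have "(\<Sum>j<n. \<integral>\<^sup>+v. \<integral>\<^sup>+z. \<integral>\<^sup>+z'. f (fst z + fst z' + toll n j) \<partial>cpl (n - 1 - j) \<partial>cpl j \<partial>U01)
      = (\<Sum>j<n. \<integral>\<^sup>+a. \<integral>\<^sup>+b. f (real (a + b + n - 1) - mu n) \<partial>X_law (n - 1 - j) \<partial>X_law j)"
    proof (intro sum.cong refl)
      fix j assume "j \<in> {..<n}"
      then have j: "j < n" "n - 1 - j < n" by auto
      have "(\<integral>\<^sup>+v. \<integral>\<^sup>+z. \<integral>\<^sup>+z'. f (fst z + fst z' + toll n j) \<partial>cpl (n - 1 - j) \<partial>cpl j \<partial>U01)
        = (\<integral>\<^sup>+z. \<integral>\<^sup>+z'. f (fst z + fst z' + toll n j) \<partial>cpl (n - 1 - j) \<partial>cpl j)"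
        by (simp add: prob_space.emeasure_space_1[OF prob_space_U01, simplified])
      also have "\<dots> = (\<integral>\<^sup>+z. \<integral>\<^sup>+b. f (fst z + (real b - mu (n - 1 - j)) + toll n j) \<partial>X_law (n - 1 - j) \<partial>cpl j)"
        by (subst less.IH[OF j(2), of "\<lambda>w. f (_ + w + toll n j)"]) auto
      also have "\<dots> = (\<integral>\<^sup>+a. \<integral>\<^sup>+b. f ((real a - mu j) + (real b - mu (n - 1 - j)) + toll n j) \<partial>X_law (n - 1 - j) \<partial>X_law j)"
      proof (rule less.IH[OF j(1), of "\<lambda>w. \<integral>\<^sup>+b. f (w + (real b - mu (n - 1 - j)) + toll n j) \<partial>X_law (n - 1 - j)"])
        show "(\<lambda>w. \<integral>\<^sup>+b. f (w + (real b - mu (n - 1 - j)) + toll n j) \<partial>X_law (n - 1 - j)) \<in> borel_measurable borel"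
          by (intro measure_pmf.borel_measurable_nn_integral) measurable
      qed
      also have "\<dots> = (\<integral>\<^sup>+a. \<integral>\<^sup>+b. f (real (a + b + n - 1) - mu n) \<partial>X_law (n - 1 - j) \<partial>X_law j)"
      proof -
        have "(real a - mu j) + (real b - mu (n - 1 - j)) + toll n j = real (a + b + n - 1) - mu n" for a b
          using False by (simp add: toll_def)
        then show ?thesis by simp
      qed
      finally show "(\<integral>\<^sup>+v. \<integral>\<^sup>+z. \<integral>\<^sup>+z'. f (fst z + fst z' + toll n j) \<partial>cpl (n - 1 - j) \<partial>cpl j \<partial>U01)
        = (\<integral>\<^sup>+a. \<integral>\<^sup>+b. f (real (a + b + n - 1) - mu n) \<partial>X_law (n - 1 - j) \<partial>X_law j)" .
    qed
    also have "\<dots> / of_nat n = (\<integral>\<^sup>+k. f (real k - mu n) \<partial>X_law n)"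
      using False by (subst nn_integral_X_law_rec[of n]) auto
    finally show ?thesis .
  qed
qed

lemma nn_integral_fixpoint:
  assumes [measurable]: "f \<in> borel_measurable borel"
  shows "(\<integral>\<^sup>+u. \<integral>\<^sup>+y. \<integral>\<^sup>+y'. f (u * y + (1 - u) * y' + Ctoll u) \<partial>Y \<partial>Y \<partial>U01) = (\<integral>\<^sup>+y. f y \<partial>Y)"
proof -
  have [measurable]: "Ctoll \<in> borel_measurable borel" unfolding Ctoll_def by measurable
  have "(\<integral>\<^sup>+y. f y \<partial>Y) = (\<integral>\<^sup>+y. f y \<partial>distr (U01 \<Otimes>\<^sub>M (Y \<Otimes>\<^sub>M Y)) borel (\<lambda>(u, y, y'). u * y + (1 - u) * y' + Ctoll u))"
    using fixpoint by simp
  also have "\<dots> = (\<integral>\<^sup>+x. f ((\<lambda>(u, y, y'). u * y + (1 - u) * y' + Ctoll u) x) \<partial>(U01 \<Otimes>\<^sub>M (Y \<Otimes>\<^sub>M Y)))"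
    by (intro nn_integral_distr) auto
  also have "\<dots> = (\<integral>\<^sup>+u. \<integral>\<^sup>+y. \<integral>\<^sup>+y'. f (u * y + (1 - u) * y' + Ctoll u) \<partial>Y \<partial>Y \<partial>U01)"
    by (subst nn_integral_triple) (auto intro: prob_space_axioms)
  finally show ?thesis by simp
qed

text \<open>By induction both subproblems contribute copies of \<open>Y\<close>. The split point,
  averaged over \<open>j\<close> and \<open>v\<close>, is uniform by
  \<open>nn_integral_U01_subdivide\<close>, and what remains is the fixed point equation.\<close>

lemma nn_integral_cpl_snd:
  assumes "f \<in> borel_measurable borel"
  shows "(\<integral>\<^sup>+z. f (snd z) \<partial>cpl n) = (\<integral>\<^sup>+y. f y \<partial>Y)"
  using assms
proof (induction n arbitrary: f rule: less_induct)
  case (less n)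
  note [measurable] = less.prems
  have [measurable]: "Ctoll \<in> borel_measurable borel" unfolding Ctoll_def by measurable
  show ?case
  proof (cases "n = 0")
    case True
    have "(\<integral>\<^sup>+z. f (snd z) \<partial>cpl 0) = (\<integral>\<^sup>+y. f y \<partial>Y)"
      unfolding cpl_0 by (subst nn_integral_distr) (auto intro!: borel_measurable_Pair simp: borel_prod[symmetric])
    then show ?thesis using True by simp
  next
    case False
    define g where "g = (\<lambda>u. \<integral>\<^sup>+y. \<integral>\<^sup>+y'. f (u * y + (1 - u) * y' + Ctoll u) \<partial>Y \<partial>Y)"
    have [measurable]: "g \<in> borel_measurable borel" unfolding g_def by measurable
    have "(\<integral>\<^sup>+z. f (snd z) \<partial>cpl n)
      = (\<Sum>j<n. \<integral>\<^sup>+v. \<integral>\<^sup>+z. \<integral>\<^sup>+z'. f ((real j + v) / real n * snd z + (1 - (real j + v) / real n) * snd z' + Ctoll ((real j + v) / real n))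
           \<partial>cpl (n - 1 - j) \<partial>cpl j \<partial>U01) / of_nat n"
      using False by (subst nn_integral_cpl) (auto simp: combine_def borel_prod[symmetric])
    also have "\<dots> = (\<Sum>j<n. \<integral>\<^sup>+v. g ((real j + v) / real n) \<partial>U01) / of_nat n"
    proof (intro arg_cong2[of _ _ _ _ "(/)"] sum.cong refl nn_integral_cong)
      fix j v assume "j \<in> {..<n}"
      then have j: "j < n" "n - 1 - j < n" by auto
      define u where "u = (real j + v) / real n"
      have "(\<integral>\<^sup>+z. \<integral>\<^sup>+z'. f (u * snd z + (1 - u) * snd z' + Ctoll u) \<partial>cpl (n - 1 - j) \<partial>cpl j)
         = (\<integral>\<^sup>+z. \<integral>\<^sup>+y'. f (u * snd z + (1 - u) * y' + Ctoll u) \<partial>Y \<partial>cpl j)"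
        by (subst less.IH[OF j(2), of "\<lambda>y'. f (u * _ + (1 - u) * y' + Ctoll u)"]) auto
      also have "\<dots> = g u" unfolding g_def
        by (rule less.IH[OF j(1), of "\<lambda>y. \<integral>\<^sup>+y'. f (u * y + (1 - u) * y' + Ctoll u) \<partial>Y"]) measurable
      finally show "(\<integral>\<^sup>+z. \<integral>\<^sup>+z'. f ((real j + v) / real n * snd z + (1 - (real j + v) / real n) * snd z' + Ctoll ((real j + v) / real n))
           \<partial>cpl (n - 1 - j) \<partial>cpl j) = g ((real j + v) / real n)" unfolding u_def .
    qed
    also have "\<dots> = (\<integral>\<^sup>+u. g u \<partial>U01)"
      using False by (intro nn_integral_U01_subdivide) auto
    also have "\<dots> = (\<integral>\<^sup>+y. f y \<partial>Y)"
      unfolding g_def by (rule nn_integral_fixpoint) fact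
    finally show ?thesis .
  qed
qed

lemma measurable_fst_cpl: "fst \<in> cpl n \<rightarrow>\<^sub>M borel" and measurable_snd_cpl: "snd \<in> cpl n \<rightarrow>\<^sub>M borel"
  by (subst measurable_cong_sets[OF sets_cpl refl],
      auto intro!: borel_measurable_continuous_onI continuous_on_fst continuous_on_snd)+

lemma distr_cpl_fst: "distr (cpl n) borel fst = distr (measure_pmf (X_law n)) borel (\<lambda>k. real k - mu n)"
proof (rule measure_eqI)
  fix A :: "real set" assume "A \<in> sets (distr (cpl n) borel fst)"
  then have A [measurable]: "A \<in> sets borel" by simp
  note [measurable] = measurable_fst_cpl
  show "emeasure (distr (cpl n) borel fst) A = emeasure (distr (measure_pmf (X_law n)) borel (\<lambda>k. real k - mu n)) A"
    using nn_integral_cpl_fst[of "indicator A" n]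
    by (simp add: nn_integral_distr flip: nn_integral_indicator)
qed simp

lemma distr_cpl_snd: "distr (cpl n) borel snd = Y"
proof (rule measure_eqI)
  fix A :: "real set" assume "A \<in> sets (distr (cpl n) borel snd)"
  then have A [measurable]: "A \<in> sets borel" by simp
  note [measurable] = measurable_snd_cpl
  show "emeasure (distr (cpl n) borel snd) A = emeasure Y A"
    using nn_integral_cpl_snd[of "indicator A" n]
    by (simp add: nn_integral_distr flip: nn_integral_indicator)
qed simp

end

section \<open>Moment bounds\<close>

text \<open>Evaluated at \<open>t = n\<close> on the coupling of \<open>X\<^sub>n - mu n\<close> with \<open>Y\<close>, this is \<open>X\<^sub>n - mu n\<close> for
  \<open>\<theta> = 0\<close> and \<open>n * (Y\<^sub>n - Y)\<close> for \<open>\<theta> = 1\<close>, so that both are estimated by the same recursion.\<close>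
definition dev :: "real \<Rightarrow> real \<Rightarrow> real \<times> real \<Rightarrow> real" where
  "dev \<theta> t z = fst z - \<theta> * t * snd z"

text \<open>Since \<open>n * u = j + v\<close> and
  \<open>n * (1 - u) = (n - 1 - j) + (1 - v)\<close>, the copies of \<open>Y\<close> carry weights
  slightly above the sizes of their subproblems. The excesses \<open>v\<close> and
  \<open>1 - v\<close> are the perturbation in the recursion.\<close>

lemma dev_combine:
  assumes "j < n"
  shows "dev \<theta> (real n) (combine n j v z z')
    = dev \<theta> (real j + v) z + dev \<theta> (real (n - 1 - j) + (1 - v)) z'
      + (toll n j - \<theta> * (real n * Ctoll ((real j + v) / real n)))"
proof -
  have k: "real (n - 1 - j) = real n - 1 - real j" using assms by simp
  define u where "u = (real j + v) / real n"
  have u: "real n * u = real j + v" using assms by (simp add: u_def)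
  have "\<theta> * real n * (u * a + (1 - u) * b + c) = \<theta> * ((real n * u) * a + (real n - real n * u) * b + real n * c)"
    for a b c by (simp add: algebra_simps)
  from this[of "snd z" "snd z'" "Ctoll u"] show ?thesis
    unfolding dev_def combine_def k fst_conv snd_conv u_def[symmetric] u
    by (simp add: algebra_simps)
qed

lemma real_distribution_Y_law: "real_distribution (Y_law n)"
  unfolding Y_law_def by (intro prob_space.real_distribution_distr prob_space_measure_pmf) simp

context quicksort_fixpoint
begin

definition moment :: "real \<Rightarrow> nat \<Rightarrow> nat \<Rightarrow> real" where
  "moment \<theta> m n = (\<integral>z. dev \<theta> (real n) z ^ (2*m) \<partial>cpl n)"

text \<open>Trivial at \<open>\<theta> = 0\<close> and a statement about all moments of
  \<open>Y\<close> at \<open>\<theta> = 1\<close>. Phrasing the moment bounds under it avoids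
  circularity when the case \<open>\<theta> = 0\<close> is used to prove the case
  \<open>\<theta> = 1\<close>.\<close>

definition scaled_moments :: "real \<Rightarrow> bool" where
  "scaled_moments \<theta> \<longleftrightarrow> (\<forall>i. integrable Y (\<lambda>y. (\<theta> * y) ^ i))"

lemma integrable_fst_power: "integrable (cpl n) (\<lambda>z. fst z ^ i)"
proof -
  have "integrable (distr (cpl n) borel fst) (\<lambda>w. w ^ i)"
    unfolding distr_cpl_fst
    by (subst integrable_distr_eq) (auto intro: integrable_measure_pmf_finite finite_set_X_law)
  then show ?thesis by (subst (asm) integrable_distr_eq) (auto intro: measurable_fst_cpl)
qed

lemma integral_fst: "(\<integral>z. fst z \<partial>cpl n) = 0"
proof -
  have "(\<integral>z. fst z \<partial>cpl n) = (\<integral>w. w \<partial>distr (cpl n) borel fst)"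
    by (intro integral_distr[symmetric] measurable_fst_cpl) auto
  also have "\<dots> = measure_pmf.expectation (X_law n) (\<lambda>k. real k - mu n)"
    unfolding distr_cpl_fst by (intro integral_distr) auto
  also have "\<dots> = measure_pmf.expectation (X_law n) real - mu n"
    by (subst Bochner_Integration.integral_diff) (auto intro: integrable_measure_pmf_finite finite_set_X_law)
  finally show ?thesis by (simp add: expectation_X_law)
qed

lemma integrable_cpl_snd:
  fixes f :: "real \<Rightarrow> real"
  shows "integrable Y f \<Longrightarrow> integrable (cpl n) (\<lambda>z. f (snd z))"
  using integrable_distr[OF measurable_snd_cpl[of n], of f] by (simp add: distr_cpl_snd)

lemma integral_cpl_snd:
  fixes f :: "real \<Rightarrow> real"
  assumes "f \<in> borel_measurable borel"
  shows "(\<integral>z. f (snd z) \<partial>cpl n) = (\<integral>y. f y \<partial>Y)"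
  using integral_distr[OF measurable_snd_cpl[of n] assms] by (simp add: distr_cpl_snd)

lemma measurable_dev: "dev \<theta> t \<in> borel_measurable (cpl n)"
proof -
  note [measurable] = measurable_fst_cpl measurable_snd_cpl
  show ?thesis unfolding dev_def[abs_def] by measurable
qed

lemma measurable_dev_borel: "dev \<theta> t \<in> borel_measurable borel"
  using measurable_dev[of \<theta> t 0] unfolding measurable_cong_sets[OF sets_cpl refl] .

lemma integrable_dev:
  assumes "scaled_moments \<theta>"
  shows "integrable (cpl n) (\<lambda>z. dev \<theta> t z ^ i)"
proof -
  note [measurable] = measurable_dev
  obtain K :: real where K: "K \<ge> 0" "\<And>x c :: real. (x + c) ^ (2*i) \<le> 9/8 * x ^ (2*i) + K * c ^ (2*i)"
    using even_power_add_le[of i] by blast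
  have m: "integrable (cpl n) (\<lambda>z. (\<theta> * snd z) ^ (2*i))"
    using assms by (intro integrable_cpl_snd[of "\<lambda>y. (\<theta> * y) ^ (2*i)"]) (simp only: scaled_moments_def)
  have "integrable (cpl n) (\<lambda>z. 1 + 9/8 * fst z ^ (2*i) + K * ((- t) ^ (2*i) * (\<theta> * snd z) ^ (2*i)))"
    using finite_measure.integrable_const[OF prob_space.finite_measure[OF prob_space_cpl], of n "1 :: real"]
    by (intro Bochner_Integration.integrable_add integrable_mult_right integrable_fst_power m)
  moreover have "(\<lambda>z. dev \<theta> t z ^ i) \<in> borel_measurable (cpl n)" by measurable
  ultimately show ?thesis
  proof (rule Bochner_Integration.integrable_bound, intro AE_I2)
    fix z
    have "norm (dev \<theta> t z ^ i) \<le> 1 + (dev \<theta> t z ^ i)\<^sup>2"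
    proof -
      have "\<bar>x\<bar> \<le> 1 + x\<^sup>2" for x :: real
        using zero_le_power2[of "\<bar>x\<bar> - 1"] abs_ge_zero[of x] unfolding power2_diff power2_abs power_one by linarith
      from this[of "dev \<theta> t z ^ i"] show ?thesis by (simp only: real_norm_def)
    qed
    also have "(dev \<theta> t z ^ i)\<^sup>2 = dev \<theta> t z ^ (2*i)"
      by (simp only: power_mult[symmetric] mult.commute)
    also have "\<dots> = (fst z + (- t) * (\<theta> * snd z)) ^ (2*i)" by (simp add: dev_def mult_ac)
    also have "\<dots> \<le> 9/8 * fst z ^ (2*i) + K * ((- t) * (\<theta> * snd z)) ^ (2*i)" by (rule K(2))
    finally have "norm (dev \<theta> t z ^ i) \<le> 1 + 9/8 * fst z ^ (2*i) + K * ((- t) ^ (2*i) * (\<theta> * snd z) ^ (2*i))"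
      unfolding power_mult_distrib[of "- t"] by (simp only: add.assoc add_le_cancel_left)
    then show "norm (dev \<theta> t z ^ i) \<le> norm (1 + 9/8 * fst z ^ (2*i) + K * ((- t) ^ (2*i) * (\<theta> * snd z) ^ (2*i)))"
      by (rule order.trans) (simp only: real_norm_def abs_ge_self)
  qed
qed

lemma integral_dev:
  assumes "scaled_moments \<theta>"
  shows "(\<integral>z. dev \<theta> t z \<partial>cpl n) = 0"
proof -
  have i: "integrable Y (\<lambda>y. \<theta> * y)" using assms[unfolded scaled_moments_def, rule_format, of 1] by simp
  have "integrable (cpl n) fst" using integrable_fst_power[of n 1] by simp
  then have "(\<integral>z. dev \<theta> t z \<partial>cpl n) = (\<integral>z. fst z \<partial>cpl n) - t * (\<integral>z. \<theta> * snd z \<partial>cpl n)"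
    using integrable_cpl_snd[OF i, of n] unfolding dev_def mult.commute[of \<theta> t] mult.assoc
    by (subst Bochner_Integration.integral_diff) auto
  also have "(\<integral>z. \<theta> * snd z \<partial>cpl n) = \<theta> * (\<integral>y. y \<partial>Y)"
    by (subst integral_cpl_snd[of "\<lambda>y. \<theta> * y"]) auto
  finally show ?thesis by (simp add: integral_fst mean_zero)
qed

lemma moment_nonneg: "0 \<le> moment \<theta> m n"
  unfolding moment_def by (intro integral_nonneg_AE AE_I2) (simp add: power_mult)

lemma moment_0: "m \<ge> 1 \<Longrightarrow> moment \<theta> m 0 = 0"
proof -
  assume m: "m \<ge> 1"
  have "moment \<theta> m 0 = (\<integral>z. fst z ^ (2*m) \<partial>cpl 0)" by (simp add: moment_def dev_def)
  also have "\<dots> = (\<integral>w. w ^ (2*m) \<partial>distr (cpl 0) borel fst)"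
    by (intro integral_distr[symmetric] measurable_fst_cpl) auto
  also have "\<dots> = measure_pmf.expectation (X_law 0) (\<lambda>k. (real k - mu 0) ^ (2*m))"
    unfolding distr_cpl_fst by (intro integral_distr) auto
  also have "\<dots> = 0" using m by (simp add: X_law_0 mu_def)
  finally show ?thesis .
qed

lemma nn_integral_dev_power:
  assumes "scaled_moments \<theta>"
  shows "(\<integral>\<^sup>+z. ennreal (dev \<theta> (real n) z ^ (2*m)) \<partial>cpl n) = ennreal (moment \<theta> m n)"
  unfolding moment_def
  by (intro nn_integral_eq_integral integrable_dev assms) (auto simp: power_mult)

text \<open>Conditioning on \<open>j\<close> and \<open>v\<close> leaves two independent
  subproblems. The bound \<open>B j\<close> must be uniform in \<open>v\<close>, so averaging over
  \<open>v\<close> is free and only the mean over \<open>j\<close> remains.\<close>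

lemma moment_le:
  assumes "scaled_moments \<theta>" and n: "n \<ge> 1" and B0: "\<And>j. j < n \<Longrightarrow> 0 \<le> B j"
    and B: "\<And>j v. j < n \<Longrightarrow> 0 < v \<Longrightarrow> v < 1 \<Longrightarrow>
      (\<integral>\<^sup>+z. \<integral>\<^sup>+z'. ennreal ((dev \<theta> (real j + v) z + dev \<theta> (real (n - 1 - j) + (1 - v)) z'
        + (toll n j - \<theta> * (real n * Ctoll ((real j + v) / real n)))) ^ (2*m)) \<partial>cpl (n - 1 - j) \<partial>cpl j) \<le> ennreal (B j)"
  shows "moment \<theta> m n \<le> (\<Sum>j<n. B j) / real n"
proof -
  note [measurable] = measurable_dev_borel
  interpret U: prob_space U01 by (rule prob_space_U01)
  have "ennreal (moment \<theta> m n) = (\<integral>\<^sup>+z. ennreal (dev \<theta> (real n) z ^ (2*m)) \<partial>cpl n)"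
    by (rule nn_integral_dev_power[OF assms(1), symmetric])
  also have "\<dots> = (\<Sum>j<n. \<integral>\<^sup>+v. \<integral>\<^sup>+z. \<integral>\<^sup>+z'. ennreal (dev \<theta> (real n) (combine n j v z z') ^ (2*m))
      \<partial>cpl (n - 1 - j) \<partial>cpl j \<partial>U01) / of_nat n"
    using n by (intro nn_integral_cpl) measurable
  also have "\<dots> \<le> (\<Sum>j<n. ennreal (B j)) / of_nat n"
  proof (intro divide_right_mono_ennreal sum_mono)
    fix j assume "j \<in> {..<n}"
    then have j: "j < n" by simp
    have "(\<integral>\<^sup>+v. \<integral>\<^sup>+z. \<integral>\<^sup>+z'. ennreal (dev \<theta> (real n) (combine n j v z z') ^ (2*m))
      \<partial>cpl (n - 1 - j) \<partial>cpl j \<partial>U01) \<le> (\<integral>\<^sup>+v. ennreal (B j) \<partial>U01)"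
    proof (intro nn_integral_mono_AE AE_uniform_measureI AE_I2 impI)
      fix v :: real assume "v \<in> {0<..<1}"
      then show "(\<integral>\<^sup>+z. \<integral>\<^sup>+z'. ennreal (dev \<theta> (real n) (combine n j v z z') ^ (2*m)) \<partial>cpl (n - 1 - j) \<partial>cpl j) \<le> ennreal (B j)"
        unfolding dev_combine[OF j] using B[OF j] by simp
    qed simp
    also have "\<dots> = ennreal (B j)" using U.emeasure_space_1 by simp
    finally show "(\<integral>\<^sup>+v. \<integral>\<^sup>+z. \<integral>\<^sup>+z'. ennreal (dev \<theta> (real n) (combine n j v z z') ^ (2*m))
      \<partial>cpl (n - 1 - j) \<partial>cpl j \<partial>U01) \<le> ennreal (B j)" .
  qed
  also have "\<dots> = ennreal ((\<Sum>j<n. B j) / real n)"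
    using n B0 divide_ennreal[of "\<Sum>j<n. B j" "real n"] sum_nonneg[of "{..<n}" B]
    by (subst sum_ennreal) (auto simp: ennreal_of_nat_eq_real_of_nat)
  finally show ?thesis
    using B0 by (subst (asm) ennreal_le_iff) (auto intro!: divide_nonneg_nonneg sum_nonneg)
qed

lemma dev_shift: "dev \<theta> (t + v) z = dev \<theta> t z + (- v) * (\<theta> * snd z)"
  by (simp add: dev_def algebra_simps)

text \<open>Changing the weight from \<open>j\<close> to \<open>j + v\<close> adds at most
  \<open>\<bar>\<theta> * Y\<bar>\<close> in absolute value, whatever \<open>j\<close> is, so the
  price is a fixed moment of \<open>\<theta> * Y\<close>. The factor \<open>9/8\<close> is harmless
  only in the contracting case.\<close>

lemma shifted_moment_le:
  assumes "scaled_moments \<theta>"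
  obtains K where "K \<ge> 0"
    "\<And>j v. 0 \<le> v \<Longrightarrow> v \<le> 1 \<Longrightarrow> (\<integral>z. dev \<theta> (real j + v) z ^ (2*m) \<partial>cpl j) \<le> 9/8 * moment \<theta> m j + K"
proof -
  obtain K :: real where K: "K \<ge> 0" "\<And>x c :: real. (x + c) ^ (2*m) \<le> 9/8 * x ^ (2*m) + K * c ^ (2*m)"
    using even_power_add_le[of m] by blast
  define L where "L = K * (\<integral>y. (\<theta> * y) ^ (2*m) \<partial>Y)"
  have "(\<integral>z. dev \<theta> (real j + v) z ^ (2*m) \<partial>cpl j) \<le> 9/8 * moment \<theta> m j + L" if v: "0 \<le> v" "v \<le> 1" for j v
  proof -
    have i: "integrable (cpl j) (\<lambda>z. (\<theta> * snd z) ^ (2*m))"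
      using assms by (intro integrable_cpl_snd[of "\<lambda>y. (\<theta> * y) ^ (2*m)"]) (simp only: scaled_moments_def)
    have "(\<integral>z. dev \<theta> (real j + v) z ^ (2*m) \<partial>cpl j) \<le> (\<integral>z. 9/8 * dev \<theta> (real j) z ^ (2*m) + K * (\<theta> * snd z) ^ (2*m) \<partial>cpl j)"
    proof (intro integral_mono integrable_dev assms Bochner_Integration.integrable_add integrable_mult_right i)
      fix z :: "real \<times> real"
      have "((- v) * (\<theta> * snd z)) ^ (2*m) = (v\<^sup>2) ^ m * (\<theta> * snd z) ^ (2*m)"
        unfolding power_mult_distrib[of "- v"] by (simp add: power_mult)
      also have "\<dots> \<le> 1 * (\<theta> * snd z) ^ (2*m)"
        using v by (intro mult_right_mono power_le_one) (auto simp: power_le_one power_mult)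
      finally have "K * ((- v) * (\<theta> * snd z)) ^ (2*m) \<le> K * (\<theta> * snd z) ^ (2*m)"
        using K(1) by (intro mult_left_mono) auto
      then show "dev \<theta> (real j + v) z ^ (2*m) \<le> 9/8 * dev \<theta> (real j) z ^ (2*m) + K * (\<theta> * snd z) ^ (2*m)"
        using K(2)[of "dev \<theta> (real j) z" "(- v) * (\<theta> * snd z)"] unfolding dev_shift by linarith
    qed
    also have "\<dots> = 9/8 * moment \<theta> m j + L"
      using i integrable_dev[OF assms] integral_cpl_snd[of "\<lambda>y. (\<theta> * y) ^ (2*m)" j]
      by (simp add: moment_def L_def)
    finally show ?thesis .
  qed
  moreover have "L \<ge> 0" unfolding L_def
    by (intro mult_nonneg_nonneg K integral_nonneg_AE AE_I2) (simp add: power_mult)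
  ultimately show ?thesis using that by blast
qed

lemma scaled_moments_0: "scaled_moments 0"
  unfolding scaled_moments_def by simp

lemma second_moment_le:
  assumes sm: "scaled_moments \<theta>" and j: "j < n"
    and a: "(\<integral>z. (dev \<theta> (real j + v) z)\<^sup>2 \<partial>cpl j) \<le> a"
    and b: "(\<integral>z. (dev \<theta> (real (n - 1 - j) + (1 - v)) z)\<^sup>2 \<partial>cpl (n - 1 - j)) \<le> b"
    and c: "c\<^sup>2 \<le> d"
  shows "(\<integral>\<^sup>+z. \<integral>\<^sup>+z'. ennreal ((dev \<theta> (real j + v) z + dev \<theta> (real (n - 1 - j) + (1 - v)) z' + c) ^ (2*1))
      \<partial>cpl (n - 1 - j) \<partial>cpl j) \<le> ennreal (a + b + d)"
proof -
  have i: "integrable (cpl k) (dev \<theta> t)" for k t using integrable_dev[OF sm, of k t 1] by simp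
  have "(\<integral>\<^sup>+z. \<integral>\<^sup>+z'. ennreal ((dev \<theta> (real j + v) z + dev \<theta> (real (n - 1 - j) + (1 - v)) z' + c)\<^sup>2)
      \<partial>cpl (n - 1 - j) \<partial>cpl j) \<le> ennreal ((\<integral>z. (dev \<theta> (real j + v) z)\<^sup>2 \<partial>cpl j)
         + (\<integral>z. (dev \<theta> (real (n - 1 - j) + (1 - v)) z)\<^sup>2 \<partial>cpl (n - 1 - j)) + c\<^sup>2)"
    by (intro second_moment_independent_sum prob_space_cpl i integrable_dev sm integral_dev)
  also have "\<dots> \<le> ennreal (a + b + d)" using a b c by (intro ennreal_leI) linarith
  finally show ?thesis by simp
qed

text \<open>Measured against \<open>n ^ 2\<close> even the second moment recurrence contracts. At
  \<open>\<theta> = 0\<close> the weight of \<open>Y\<close> is irrelevant, and the squared toll is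
  at most \<open>3000 * n ^ 2\<close>; \<open>21000 = 7 * 3000\<close>.\<close>

lemma moment_0_1_le: "moment 0 1 n \<le> 21000 * real n ^ 2"
proof -
  have "moment 0 1 n \<le> 7 * 3000 * real n ^ 2"
  proof (rule contracting_recurrence_bound)
    fix n :: nat assume n: "n \<ge> 1"
    have d: "(\<integral>z. (dev 0 t z)\<^sup>2 \<partial>cpl k) = moment 0 1 k" for t k by (simp add: moment_def dev_def)
    have "moment 0 1 n \<le> (\<Sum>j<n. moment 0 1 j + moment 0 1 (n - 1 - j) + 3000 * (real n)\<^sup>2) / real n"
      by (intro moment_le second_moment_le scaled_moments_0 n add_nonneg_nonneg moment_nonneg)
         (auto simp: d toll_sq_le)
    also have "\<dots> = 1 * ((\<Sum>j<n. moment 0 1 j + moment 0 1 (n - 1 - j)) / real n) + 3000 * real n ^ 2"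
      using n by (simp add: sum.distrib field_simps)
    also have "\<dots> \<le> 81/64 * ((\<Sum>j<n. moment 0 1 j + moment 0 1 (n - 1 - j)) / real n) + 3000 * real n ^ 2"
      by (intro add_right_mono mult_right_mono divide_nonneg_nonneg sum_nonneg add_nonneg_nonneg moment_nonneg) auto
    finally show "moment 0 1 n \<le> 81/64 * ((\<Sum>j<n. moment 0 1 j + moment 0 1 (n - 1 - j)) / real n) + 3000 * real n ^ 2" .
  qed (auto simp: moment_0)
  then show ?thesis by simp
qed

text \<open>The difference for a subproblem and the copy of \<open>Y\<close> multiplying the excess
  weight are dependent, so their cross term does not vanish. It is split with a weight that grows
  with the size of the subproblem, which keeps the multiplicative loss within the critical
  recurrence.\<close>

lemma moment_1_1_le:
  assumes sm: "scaled_moments 1"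
  obtains K where "K \<ge> 0" "\<And>n. moment 1 1 n \<le> K * real n"
proof -
  define s where "s = (\<integral>y. y\<^sup>2 \<partial>Y)"
  have s: "s \<ge> 0" by (simp add: s_def)
  have iY: "integrable Y (\<lambda>y. y\<^sup>2)" using sm[unfolded scaled_moments_def, rule_format, of 2] by simp
  define e where "e = (\<lambda>k. 1 / (16 * sqrt (real k + 1)))"
  have shift: "(\<integral>z. (dev 1 (real k + v) z)\<^sup>2 \<partial>cpl k) \<le> (1 + e k) * moment 1 1 k + 17 * s * sqrt n"
    if v: "0 \<le> v" "v \<le> 1" and k: "k < n" for k v n
  proof -
    \<comment> \<open>The weight in Young's inequality for the cross term. \<open>1 + 1 / r\<close>
      is the factor that \<open>critical_recurrence_bound\<close> tolerates, and the price
      \<open>(1 + r) * s\<close> stays of order \<open>sqrt n\<close>, the order of the squared toll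
      error.\<close>
    define r where "r = 16 * sqrt (real k + 1)"
    have r: "r > 0" "e k = 1 / r" by (auto simp: r_def e_def)
    have i: "integrable (cpl k) (\<lambda>z. (snd z)\<^sup>2)" by (rule integrable_cpl_snd[OF iY])
    have "(\<integral>z. (dev 1 (real k + v) z)\<^sup>2 \<partial>cpl k) \<le> (\<integral>z. (1 + 1 / r) * (dev 1 (real k) z)\<^sup>2 + (1 + r) * (snd z)\<^sup>2 \<partial>cpl k)"
    proof (intro integral_mono integrable_dev sm Bochner_Integration.integrable_add integrable_mult_right i)
      fix z :: "real \<times> real"
      define x y where "x = dev 1 (real k) z" and "y = snd z"
      have "0 \<le> (x / sqrt r + v * y * sqrt r)\<^sup>2" by simp
      also have "\<dots> = x\<^sup>2 / r + 2 * v * x * y + r * (v * y)\<^sup>2"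
        using r by (simp add: power2_sum power_divide power_mult_distrib)
      finally have "(x - v * y)\<^sup>2 \<le> (1 + 1 / r) * x\<^sup>2 + (1 + r) * (v * y)\<^sup>2"
        by (simp add: power2_diff algebra_simps)
      also have "(v * y)\<^sup>2 \<le> y\<^sup>2"
        using v mult_right_mono[of "v\<^sup>2" 1 "y\<^sup>2"] by (simp add: power_mult_distrib power_le_one)
      finally show "(dev 1 (real k + v) z)\<^sup>2 \<le> (1 + 1 / r) * (dev 1 (real k) z)\<^sup>2 + (1 + r) * (snd z)\<^sup>2"
        using r unfolding dev_shift x_def[symmetric] y_def[symmetric] by (simp add: mult_left_mono)
    qed
    also have "\<dots> = (1 + e k) * moment 1 1 k + (1 + r) * s"
      using i integrable_dev[OF sm, of k "real k" 2] integral_cpl_snd[of "\<lambda>y. y\<^sup>2" k]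
      by (simp add: moment_def s_def r)
    also have "(1 + r) * s \<le> 17 * sqrt n * s"
    proof (intro mult_right_mono s)
      have "sqrt (real k + 1) \<le> sqrt n" "1 \<le> sqrt n" using k by auto
      then show "1 + r \<le> 17 * sqrt n" unfolding r_def by linarith
    qed
    finally show ?thesis by (simp add: mult_ac)
  qed
  \<comment> \<open>Twice \<open>17 * s\<close> for the two shifted subproblems, plus the constant
    of \<open>toll_approx_sq\<close>.\<close>
  define K where "K = 34 * s + 1458"
  have "moment 1 1 n \<le> 12 * K * real n" for n
  proof (rule critical_recurrence_bound)
    show "moment 1 1 0 = 0" by (simp add: moment_0)
    show "0 \<le> K" using s by (simp add: K_def)
    fix n :: nat assume n: "n \<ge> 1"
    define f where "f = (\<lambda>k. (1 + e k) * moment 1 1 k)"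
    have f0: "0 \<le> f k" for k unfolding f_def e_def
      by (intro mult_nonneg_nonneg moment_nonneg) auto
    have "moment 1 1 n \<le> (\<Sum>j<n. (f j + 17 * s * sqrt n) + (f (n - 1 - j) + 17 * s * sqrt n) + 1458 * sqrt n) / real n"
    proof (rule moment_le[OF sm n])
      fix j v assume j: "j < n" and v: "0 < v" "v < (1::real)"
      show "(\<integral>\<^sup>+ z. \<integral>\<^sup>+ z'. ennreal ((dev 1 (real j + v) z + dev 1 (real (n - 1 - j) + (1 - v)) z' +
             (toll n j - 1 * (real n * Ctoll ((real j + v) / real n)))) ^ (2 * 1)) \<partial>cpl (n - 1 - j) \<partial>cpl j)
         \<le> ennreal ((f j + 17 * s * sqrt n) + (f (n - 1 - j) + 17 * s * sqrt n) + 1458 * sqrt n)"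
        unfolding f_def
        by (intro second_moment_le sm j shift) (use j v toll_approx_sq[OF j v] in auto)
    qed (use f0 s in simp)
    also have "(\<Sum>j<n. (f j + 17 * s * sqrt n) + (f (n - 1 - j) + 17 * s * sqrt n) + 1458 * sqrt n)
       = 2 * (\<Sum>j<n. f j) + real n * (K * sqrt n)"
      using sum.nat_diff_reindex[of f n] by (simp add: sum.distrib K_def algebra_simps)
    also have "\<dots> / real n = 2 / n * (\<Sum>j<n. f j) + K * sqrt n"
      using n by (simp add: field_simps)
    finally show "moment 1 1 n \<le> 2 / n * (\<Sum>j<n. (1 + 1 / (16 * sqrt (real j + 1))) * moment 1 1 j) + K * sqrt n"
      by (simp add: f_def e_def)
  qed
  moreover have "0 \<le> 12 * K" using s by (simp add: K_def)
  ultimately show ?thesis using that by blast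
qed

text \<open>Each moment is \<open>O(n ^ (\<kappa> * m))\<close> once the second moment and the
  squared toll are \<open>O(n ^ \<kappa>)\<close>. It is used with \<open>\<kappa> = 2\<close> for
  the centred count and \<open>\<kappa> = 1\<close> for the difference. A cross term is a moment of
  order \<open>2 * (m - 1)\<close> times a second moment, hence again of growth
  \<open>\<kappa> * m\<close>. As \<open>m \<ge> 2\<close> in the induction step,
  \<open>\<kappa> * m \<ge> 2\<close> and the recurrence contracts.\<close>

lemma moment_growth:
  assumes sm: "scaled_moments \<theta>" and \<kappa>: "\<kappa> \<ge> (1::nat)" and L: "L \<ge> 0"
    and toll: "\<And>n j v. j < n \<Longrightarrow> 0 < v \<Longrightarrow> v < 1 \<Longrightarrow>
       (toll n j - \<theta> * (real n * Ctoll ((real j + v) / real n)))\<^sup>2 \<le> L * real n ^ \<kappa>"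
    and K1: "K1 \<ge> 0" "\<And>n. moment \<theta> 1 n \<le> K1 * real n ^ \<kappa>"
    and m: "m \<ge> 1"
  shows "\<exists>K\<ge>0. \<forall>n. moment \<theta> m n \<le> K * real n ^ (\<kappa> * m)"
  using m
proof (induction m rule: nat_induct_at_least)
  case base
  then show ?case using K1 by auto
next
  case (Suc l)
  define m where "m = Suc l"
  have m: "m \<ge> 2" "m - 1 = l" using Suc.hyps by (auto simp: m_def)
  obtain K' where K': "K' \<ge> 0" "\<And>n. moment \<theta> l n \<le> K' * real n ^ (\<kappa> * l)" using Suc.IH by blast
  obtain Ca where Ca: "Ca \<ge> 0" "\<And>j v. 0 \<le> v \<Longrightarrow> v \<le> 1 \<Longrightarrow> (\<integral>z. dev \<theta> (real j + v) z ^ (2*m) \<partial>cpl j) \<le> 9/8 * moment \<theta> m j + Ca"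
    using shifted_moment_le[OF sm, of m] by blast
  obtain Cb where Cb: "Cb \<ge> 0" "\<And>j v. 0 \<le> v \<Longrightarrow> v \<le> 1 \<Longrightarrow> (\<integral>z. dev \<theta> (real j + v) z ^ (2*l) \<partial>cpl j) \<le> 9/8 * moment \<theta> l j + Cb"
    using shifted_moment_le[OF sm, of l] by blast
  obtain Cc where Cc: "Cc \<ge> 0" "\<And>j v. 0 \<le> v \<Longrightarrow> v \<le> 1 \<Longrightarrow> (\<integral>z. dev \<theta> (real j + v) z ^ (2*1) \<partial>cpl j) \<le> 9/8 * moment \<theta> 1 j + Cc"
    using shifted_moment_le[OF sm, of 1] by blast
  obtain K :: real where K: "K \<ge> 0"
    "\<And>(P :: (real \<times> real) measure) (Q :: (real \<times> real) measure) f g c.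
       prob_space P \<Longrightarrow> prob_space Q \<Longrightarrow>
       (\<And>i. integrable P (\<lambda>x. f x ^ i)) \<Longrightarrow> (\<And>i. integrable Q (\<lambda>y. g y ^ i)) \<Longrightarrow>
       (\<integral>x. f x \<partial>P) = 0 \<Longrightarrow> (\<integral>y. g y \<partial>Q) = 0 \<Longrightarrow>
       (\<integral>\<^sup>+x. \<integral>\<^sup>+y. ennreal ((f x + g y + c) ^ (2*m)) \<partial>Q \<partial>P)
       \<le> ennreal (9/8 * ((\<integral>x. f x ^ (2*m) \<partial>P) + (\<integral>y. g y ^ (2*m) \<partial>Q))
          + K * ((\<integral>x. f x ^ (2*(m-1)) \<partial>P) * (\<integral>y. g y ^ 2 \<partial>Q)
               + (\<integral>x. f x ^ 2 \<partial>P) * (\<integral>y. g y ^ (2*(m-1)) \<partial>Q) + c ^ (2*m)))"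
    using even_moment_independent_sum[OF m(1)] by blast
  define D1 where "D1 = 9/8 * K' + Cb"
  define D2 where "D2 = 9/8 * K1 + Cc"
  have D: "D1 \<ge> 0" "D2 \<ge> 0" using K' K1 Cb Cc by (auto simp: D1_def D2_def)
  have low: "(\<integral>z. dev \<theta> (real j + v) z ^ (2*l) \<partial>cpl j) \<le> D1 * real n ^ (\<kappa> * l)"
    "(\<integral>z. (dev \<theta> (real j + v) z)\<^sup>2 \<partial>cpl j) \<le> D2 * real n ^ \<kappa>"
    if "0 \<le> v" "v \<le> 1" "j < n" for j v n
  proof -
    have p: "1 \<le> real n ^ q" "real j ^ q \<le> real n ^ q" for q
      using that(3) by (auto intro!: power_mono one_le_power)
    have "(\<integral>z. dev \<theta> (real j + v) z ^ (2*l) \<partial>cpl j) \<le> 9/8 * (K' * real j ^ (\<kappa> * l)) + Cb"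
      using Cb(2)[OF that(1,2), of j] K'(2)[of j] by linarith
    also have "\<dots> \<le> 9/8 * (K' * real n ^ (\<kappa> * l)) + Cb * real n ^ (\<kappa> * l)"
      using K'(1) Cb(1) p[of "\<kappa> * l"] by (intro add_mono mult_left_mono) (auto simp: mult_le_cancel_left1)
    finally show "(\<integral>z. dev \<theta> (real j + v) z ^ (2*l) \<partial>cpl j) \<le> D1 * real n ^ (\<kappa> * l)"
      by (simp add: D1_def algebra_simps)
    have "(\<integral>z. dev \<theta> (real j + v) z ^ (2*1) \<partial>cpl j) \<le> 9/8 * (K1 * real j ^ \<kappa>) + Cc"
      using Cc(2)[OF that(1,2), of j] K1(2)[of j] by linarith
    also have "\<dots> \<le> 9/8 * (K1 * real n ^ \<kappa>) + Cc * real n ^ \<kappa>"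
      using K1(1) Cc(1) p[of \<kappa>] by (intro add_mono mult_left_mono) (auto simp: mult_le_cancel_left1)
    finally show "(\<integral>z. (dev \<theta> (real j + v) z)\<^sup>2 \<partial>cpl j) \<le> D2 * real n ^ \<kappa>"
      by (simp add: D2_def algebra_simps power2_eq_square)
  qed
  \<comment> \<open>All inhomogeneous terms in units of \<open>n ^ (\<kappa> * m)\<close>: the shift
    constant \<open>Ca\<close> of both subproblems times \<open>9/8\<close>, two cross products, and
    the toll to the power \<open>2 * m\<close>.\<close>
  define Kf where "Kf = 9/4 * Ca + K * (2 * D1 * D2 + L ^ m)"
  have Kf: "Kf \<ge> 0" using K Ca D L by (simp add: Kf_def)
  have "moment \<theta> m n \<le> 7 * Kf * real n ^ (\<kappa> * m)" for n
  proof (rule contracting_recurrence_bound[of "moment \<theta> m"])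
    show "moment \<theta> m 0 = 0" using m by (simp add: moment_0)
    show "Kf \<ge> 0" by fact
    show "2 \<le> \<kappa> * m" using \<kappa> m mult_mono[of 1 \<kappa> 2 m] by simp
    fix n :: nat assume n: "n \<ge> 1"
    define q where "q = real n ^ (\<kappa> * m)"
    have q: "q \<ge> 1" using n by (simp add: q_def one_le_power)
    have "moment \<theta> m n \<le> (\<Sum>j<n. 81/64 * (moment \<theta> m j + moment \<theta> m (n - 1 - j)) + Kf * q) / real n"
    proof (rule moment_le[OF sm n])
      show "0 \<le> 81/64 * (moment \<theta> m j + moment \<theta> m (n - 1 - j)) + Kf * q" for j
        using Kf q by (intro add_nonneg_nonneg mult_nonneg_nonneg moment_nonneg) auto
      fix j v assume j: "j < n" and v: "0 < v" "v < (1::real)"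
      define k where "k = n - 1 - j"
      have k: "k < n" using j by (simp add: k_def)
      define c where "c = toll n j - \<theta> * (real n * Ctoll ((real j + v) / real n))"
      have cc: "c ^ (2*m) \<le> L ^ m * q"
      proof -
        have "c ^ (2*m) = (c\<^sup>2) ^ m" by (simp add: power_mult)
        also have "\<dots> \<le> (L * real n ^ \<kappa>) ^ m" unfolding c_def using toll[OF j v] by (intro power_mono) auto
        also have "\<dots> = L ^ m * q" by (simp add: q_def power_mult_distrib power_mult)
        finally show ?thesis .
      qed
      have v1: "0 \<le> v" "v \<le> 1" "0 \<le> 1 - v" "1 - v \<le> 1" using v by auto
      have ev: "0 \<le> (\<integral>z. dev \<theta> t z ^ (2*i) \<partial>cpl a)" for t i a
        by (intro integral_nonneg_AE AE_I2) (simp add: power_mult)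
      have q2: "real n ^ (\<kappa> * l) * real n ^ \<kappa> = q" by (simp add: q_def m_def add.commute flip: power_add)
      have c1: "(\<integral>z. dev \<theta> (real j + v) z ^ (2*l) \<partial>cpl j) * (\<integral>z. (dev \<theta> (real k + (1 - v)) z)\<^sup>2 \<partial>cpl k) \<le> D1 * D2 * q"
      proof -
        have "(\<integral>z. dev \<theta> (real j + v) z ^ (2*l) \<partial>cpl j) * (\<integral>z. (dev \<theta> (real k + (1 - v)) z)\<^sup>2 \<partial>cpl k)
           \<le> (D1 * real n ^ (\<kappa> * l)) * (D2 * real n ^ \<kappa>)"
          by (intro mult_mono low v1 j k) (use D ev[of _ 1] in auto)
        then show ?thesis by (simp add: mult_ac flip: q2)
      qed
      have c2: "(\<integral>z. (dev \<theta> (real j + v) z)\<^sup>2 \<partial>cpl j) * (\<integral>z. dev \<theta> (real k + (1 - v)) z ^ (2*l) \<partial>cpl k) \<le> D1 * D2 * q"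
      proof -
        have "(\<integral>z. (dev \<theta> (real j + v) z)\<^sup>2 \<partial>cpl j) * (\<integral>z. dev \<theta> (real k + (1 - v)) z ^ (2*l) \<partial>cpl k)
           \<le> (D2 * real n ^ \<kappa>) * (D1 * real n ^ (\<kappa> * l))"
          by (intro mult_mono low v1 j k) (use D ev in auto)
        then show ?thesis by (simp add: mult_ac flip: q2)
      qed
      have "(\<integral>\<^sup>+ z. \<integral>\<^sup>+ z'. ennreal ((dev \<theta> (real j + v) z + dev \<theta> (real k + (1 - v)) z' + c) ^ (2 * m)) \<partial>cpl k \<partial>cpl j)
         \<le> ennreal (9/8 * ((\<integral>z. dev \<theta> (real j + v) z ^ (2*m) \<partial>cpl j) + (\<integral>z. dev \<theta> (real k + (1 - v)) z ^ (2*m) \<partial>cpl k))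
          + K * ((\<integral>z. dev \<theta> (real j + v) z ^ (2*l) \<partial>cpl j) * (\<integral>z. (dev \<theta> (real k + (1 - v)) z)\<^sup>2 \<partial>cpl k)
               + (\<integral>z. (dev \<theta> (real j + v) z)\<^sup>2 \<partial>cpl j) * (\<integral>z. dev \<theta> (real k + (1 - v)) z ^ (2*l) \<partial>cpl k) + c ^ (2*m)))"
        unfolding m(2)[symmetric]
        by (intro K(2) prob_space_cpl integrable_dev integral_dev sm)
      also have "\<dots> \<le> ennreal (9/8 * ((9/8 * moment \<theta> m j + Ca) + (9/8 * moment \<theta> m k + Ca))
          + K * (D1 * D2 * q + D1 * D2 * q + L ^ m * q))"
        by (intro ennreal_leI add_mono mult_left_mono Ca(2) v1 c1 c2 cc K(1)) auto
      also have "\<dots> \<le> ennreal (81/64 * (moment \<theta> m j + moment \<theta> m k) + Kf * q)"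
      proof (rule ennreal_leI)
        have "9/4 * Ca \<le> 9/4 * Ca * q" using Ca(1) q by (simp add: mult_le_cancel_left1)
        moreover have "Kf * q = 9/4 * Ca * q + K * (D1 * D2 * q + D1 * D2 * q + L ^ m * q)"
          by (simp add: Kf_def algebra_simps)
        ultimately show "9/8 * ((9/8 * moment \<theta> m j + Ca) + (9/8 * moment \<theta> m k + Ca))
          + K * (D1 * D2 * q + D1 * D2 * q + L ^ m * q) \<le> 81/64 * (moment \<theta> m j + moment \<theta> m k) + Kf * q"
          unfolding distrib_left by linarith
      qed
      finally show "(\<integral>\<^sup>+ z. \<integral>\<^sup>+ z'. ennreal ((dev \<theta> (real j + v) z + dev \<theta> (real (n - 1 - j) + (1 - v)) z' +
             (toll n j - \<theta> * (real n * Ctoll ((real j + v) / real n)))) ^ (2 * m)) \<partial>cpl (n - 1 - j) \<partial>cpl j)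
         \<le> ennreal (81/64 * (moment \<theta> m j + moment \<theta> m (n - 1 - j)) + Kf * q)"
        unfolding k_def c_def .
    qed
    also have "\<dots> = 81/64 * ((\<Sum>j<n. moment \<theta> m j + moment \<theta> m (n - 1 - j)) / n) + Kf * real n ^ (\<kappa> * m)"
    proof -
      have "(\<Sum>j<n. 81/64 * A j + Kf * q) / real n = 81/64 * ((\<Sum>j<n. A j) / n) + Kf * q" for A :: "nat \<Rightarrow> real"
        using n by (simp add: sum.distrib add_divide_distrib sum_divide_distrib sum_distrib_left)
      then show ?thesis by (simp only: q_def)
    qed
    finally show "moment \<theta> m n \<le> 81/64 * ((\<Sum>j<n. moment \<theta> m j + moment \<theta> m (n - 1 - j)) / n) + Kf * real n ^ (\<kappa> * m)" .
  qed
  then show ?case using Kf unfolding m_def[symmetric] by (intro exI[of _ "7 * Kf"]) auto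
qed

section \<open>Moments of the limit law and of the difference\<close>

lemma Y_law_moment:
  assumes "n \<ge> 1"
  shows "integrable (Y_law n) (\<lambda>y. y ^ (2*m))" "(\<integral>y. y ^ (2*m) \<partial>Y_law n) = moment 0 m n / real n ^ (2*m)"
proof -
  show "integrable (Y_law n) (\<lambda>y. y ^ (2*m))"
    unfolding Y_law_def by (subst integrable_distr_eq) (auto intro: integrable_measure_pmf_finite finite_set_X_law)
  have "moment 0 m n = (\<integral>z. fst z ^ (2*m) \<partial>cpl n)" by (simp add: moment_def dev_def)
  also have "\<dots> = (\<integral>w. w ^ (2*m) \<partial>distr (cpl n) borel fst)"
    by (intro integral_distr[symmetric] measurable_fst_cpl) auto
  also have "\<dots> = measure_pmf.expectation (X_law n) (\<lambda>k. (real k - mu n) ^ (2*m))"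
    unfolding distr_cpl_fst by (intro integral_distr) auto
  also have "\<dots> / real n ^ (2*m) = (\<integral>y. y ^ (2*m) \<partial>Y_law n)"
    unfolding Y_law_def by (subst integral_distr) (auto simp: power_divide)
  finally show "(\<integral>y. y ^ (2*m) \<partial>Y_law n) = moment 0 m n / real n ^ (2*m)" by simp
qed

text \<open>The moments of \<open>Y\<^sub>n\<close> are bounded uniformly in \<open>n\<close>; the truncations \<open>min (y ^ (2*m)) R\<close> carry
  the bound over to the weak limit.\<close>
lemma even_moments_integrable:
  assumes weak: "weak_conv_m Y_law Y" and m: "m \<ge> 1"
  shows "integrable Y (\<lambda>y. y ^ (2*m))"
proof -
  obtain K where K: "K \<ge> 0" "\<And>n. moment 0 m n \<le> K * real n ^ (2*m)"
    \<comment> \<open>Growth \<open>\<kappa> = 2\<close> gives moments of order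
      \<open>n ^ (2*m)\<close>, which is exactly what division by \<open>n\<close> in
      \<open>Y_law\<close> cancels.\<close>
    using moment_growth[OF scaled_moments_0, of 2 3000 21000 m] moment_0_1_le toll_sq_le m by auto
  define h where "h = (\<lambda>(R::nat) y::real. min (y ^ (2*m)) (real R))"
  have ev: "0 \<le> y ^ (2*m)" for y :: real by (simp add: power_mult)
  have h: "0 \<le> h R y" "h R y \<le> real R" "h R y \<le> y ^ (2*m)" for R y using ev[of y] by (auto simp: h_def)
  have [measurable]: "h R \<in> borel_measurable borel" for R unfolding h_def by measurable
  have ih: "integrable N (h R)" if "real_distribution N" for N R
  proof -
    interpret N: real_distribution N by fact
    show ?thesis by (rule N.integrable_const_bound[of _ "real R"]) (use h in auto)
  qed
  have bound: "(\<integral>y. h R y \<partial>Y) \<le> K" for R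
  proof (rule LIMSEQ_le_const2)
    show "(\<lambda>n. \<integral>y. h R y \<partial>Y_law n) \<longlonglongrightarrow> (\<integral>y. h R y \<partial>Y)"
    proof (rule weak_conv_imp_integral_bdd_continuous_conv[OF real_distribution_Y_law real_distribution_axioms weak])
      show "isCont (h R) x" for x unfolding h_def by (intro continuous_intros)
      show "norm (h R y) \<le> real R" for y using h[of R y] by simp
    qed
    have "(\<integral>y. h R y \<partial>Y_law n) \<le> K" if n: "n \<ge> 1" for n
    proof -
      have "(\<integral>y. h R y \<partial>Y_law n) \<le> (\<integral>y. y ^ (2*m) \<partial>Y_law n)"
        by (intro integral_mono ih real_distribution_Y_law Y_law_moment n h)
      also have "\<dots> \<le> K" using K(2)[of n] n by (simp add: Y_law_moment divide_le_eq)
      finally show ?thesis .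
    qed
    then show "\<exists>N. \<forall>n\<ge>N. (\<integral>y. h R y \<partial>Y_law n) \<le> K" by blast
  qed
  have "incseq (\<lambda>R. \<integral>y. h R y \<partial>Y)"
    by (intro incseq_SucI integral_mono ih real_distribution_axioms) (auto simp: h_def)
  then obtain l where l: "(\<lambda>R. \<integral>y. h R y \<partial>Y) \<longlonglongrightarrow> l"
    using incseq_convergent[of _ K] bound by blast
  show ?thesis
  proof (rule integral_monotone_convergence_nonneg(1)[OF ih[OF real_distribution_axioms] _ _ _ l])
    show "AE y in Y. mono (\<lambda>R. h R y)" by (auto simp: h_def mono_def)
    show "AE y in Y. 0 \<le> h R y" for R using h by auto
    show "AE y in Y. (\<lambda>R. h R y) \<longlonglongrightarrow> y ^ (2*m)"
    proof (rule AE_I2)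
      fix y
      obtain N :: nat where N: "y ^ (2*m) \<le> real N" using real_arch_simple by blast
      have "\<forall>\<^sub>F R in sequentially. h R y = y ^ (2*m)"
        using eventually_ge_at_top[of N] by eventually_elim (use N in \<open>auto simp: h_def min_def\<close>)
      then show "(\<lambda>R. h R y) \<longlonglongrightarrow> y ^ (2*m)" by (rule tendsto_eventually)
    qed
  qed simp
qed

lemma scaled_moments_1:
  assumes "weak_conv_m Y_law Y"
  shows "scaled_moments 1"
  unfolding scaled_moments_def mult_1_left
proof
  fix i
  have "integrable Y (\<lambda>y. 1 + y ^ (2 * Suc i))"
    using even_moments_integrable[OF assms, of "Suc i"] by simp
  then show "integrable Y (\<lambda>y. y ^ i)"
  proof (rule Bochner_Integration.integrable_bound, simp, intro AE_I2)
    fix y :: real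
    have "\<bar>y\<bar> ^ i \<le> 1 + \<bar>y\<bar> ^ (2 * Suc i)"
    proof (cases "\<bar>y\<bar> \<le> 1")
      case True
      then show ?thesis using power_le_one[of "\<bar>y\<bar>" i] zero_le_power[of "\<bar>y\<bar>" "2 * Suc i"] by linarith
    next
      case False
      then show ?thesis using power_increasing[of i "2 * Suc i" "\<bar>y\<bar>"] by simp
    qed
    also have "\<bar>y\<bar> ^ (2 * Suc i) = y ^ (2 * Suc i)" unfolding power_mult by simp
    finally have "norm (y ^ i) \<le> 1 + y ^ (2 * Suc i)" by (simp only: real_norm_def power_abs)
    then show "norm (y ^ i) \<le> norm (1 + y ^ (2 * Suc i))"
      by (rule order.trans) (simp only: real_norm_def abs_ge_self)
  qed
qed

text \<open>Here \<open>\<kappa> = 1\<close>. The squared toll error is \<open>O(sqrt n)\<close> and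
  is weakened to \<open>O(n)\<close>; the finer order has already been spent on the second
  moment.\<close>

lemma difference_moment_growth:
  assumes weak: "weak_conv_m Y_law Y" and m: "m \<ge> 1"
  shows "\<exists>K\<ge>0. \<forall>n. moment 1 m n \<le> K * real n ^ m"
proof -
  note sm = scaled_moments_1[OF weak]
  obtain K1 where K1: "K1 \<ge> 0" "\<And>n. moment 1 1 n \<le> K1 * real n"
    using moment_1_1_le[OF sm] by blast
  have "(toll n j - 1 * (real n * Ctoll ((real j + v) / real n)))\<^sup>2 \<le> 1458 * real n ^ 1"
    if "j < n" "0 < v" "v < 1" for n j v
  proof -
    have "sqrt n \<le> sqrt n * sqrt n" using that mult_left_mono[of 1 "sqrt n" "sqrt n"] by simp
    then show ?thesis using toll_approx_sq[OF that] by simp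
  qed
  from moment_growth[OF sm _ _ this K1(1) _ m] K1(2) show ?thesis by simp
qed

section \<open>From moments to the distance\<close>

lemma coupling_scaled_cpl:
  "coupling (distr (cpl n) borel (\<lambda>z. (fst z / real n, snd z))) (Y_law n) Y"
proof -
  interpret C: prob_space "cpl n" by (rule prob_space_cpl)
  note [measurable] = measurable_fst_cpl measurable_snd_cpl
  have m: "(\<lambda>z. (fst z / real n, snd z)) \<in> cpl n \<rightarrow>\<^sub>M borel" by (intro borel_measurable_Pair) measurable
  have f: "fst \<in> borel \<rightarrow>\<^sub>M (borel :: real measure)" "snd \<in> borel \<rightarrow>\<^sub>M (borel :: real measure)"
    by (auto intro!: borel_measurable_continuous_onI continuous_on_fst continuous_on_snd)
  have "distr (distr (cpl n) borel (\<lambda>z. (fst z / real n, snd z))) borel fst = distr (cpl n) borel (\<lambda>z. fst z / real n)"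
    using distr_distr[OF f(1) m] by (simp add: comp_def)
  also have "\<dots> = distr (distr (cpl n) borel fst) borel (\<lambda>w. w / real n)"
    by (subst distr_distr) (auto simp: comp_def)
  also have "\<dots> = Y_law n"
    unfolding distr_cpl_fst Y_law_def by (subst distr_distr) (auto simp: comp_def)
  finally have 1: "distr (distr (cpl n) borel (\<lambda>z. (fst z / real n, snd z))) borel fst = Y_law n" .
  have "distr (distr (cpl n) borel (\<lambda>z. (fst z / real n, snd z))) borel snd = distr (cpl n) borel snd"
    using distr_distr[OF f(2) m] by (simp add: comp_def)
  also have "\<dots> = Y" by (rule distr_cpl_snd)
  finally show ?thesis using 1 C.prob_space_distr[OF m] 
    unfolding coupling_def borel_prod[where 'a=real and 'b=real] by simp
qed

lemma wass_pow_le: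
  assumes weak: "weak_conv_m Y_law Y" and p: "p > 0"
  shows "\<exists>K\<ge>0. \<forall>n\<ge>1. wass_pow p (Y_law n) Y \<le> ennreal (K * real n powr (- p / 2))"
proof -
  obtain m :: nat where m: "p \<le> real m" using real_arch_simple by blast
  have m1: "m \<ge> 1" using m p by (cases m) auto
  obtain K where K: "K \<ge> 0" "\<And>n. moment 1 m n \<le> K * real n ^ m"
    using difference_moment_growth[OF weak m1] by blast
  have "wass_pow p (Y_law n) Y \<le> ennreal ((1 + K) * real n powr (- p / 2))" if n: "n \<ge> 1" for n
  proof -
    note [measurable] = measurable_fst_cpl measurable_snd_cpl
    interpret C: prob_space "cpl n" by (rule prob_space_cpl)
    have mp: "(\<lambda>z. (fst z / real n, snd z)) \<in> cpl n \<rightarrow>\<^sub>M borel" by (intro borel_measurable_Pair) measurable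
    have f [measurable]: "fst \<in> borel \<rightarrow>\<^sub>M (borel :: real measure)" "snd \<in> borel \<rightarrow>\<^sub>M (borel :: real measure)"
      by (auto intro!: borel_measurable_continuous_onI continuous_on_fst continuous_on_snd)
    define s where "s = sqrt (real n)"
    have s: "s > 0" "s * s = real n" using n by (auto simp: s_def)
    have "wass_pow p (Y_law n) Y \<le> (\<integral>\<^sup>+z. ennreal (\<bar>fst z - snd z\<bar> powr p) \<partial>distr (cpl n) borel (\<lambda>z. (fst z / real n, snd z)))"
      unfolding wass_pow_def by (rule INF_lower) (simp add: coupling_scaled_cpl)
    also have "\<dots> = (\<integral>\<^sup>+z. ennreal (\<bar>fst z / real n - snd z\<bar> powr p) \<partial>cpl n)"
      by (subst nn_integral_distr[OF mp]) auto
    also have "\<dots> \<le> ennreal (\<integral>z. s powr (- p) * (1 + dev 1 (real n) z ^ (2*m) / real n ^ m) \<partial>cpl n)"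
    proof (rule nn_integral_le_integral)
      show "integrable (cpl n) (\<lambda>z. s powr (- p) * (1 + dev 1 (real n) z ^ (2*m) / real n ^ m))"
        using integrable_dev[OF scaled_moments_1[OF weak], of n "real n" "2*m"] by simp
      fix z :: "real \<times> real"
      \<comment> \<open>The normalised difference \<open>sqrt n * \<bar>Y_n - Y\<bar>\<close>, whose
        moment of order \<open>2 * m\<close> is bounded in \<open>n\<close>; the factor
        \<open>s powr (- p)\<close> split off below is the rate.\<close>
      define x where "x = \<bar>dev 1 (real n) z\<bar> / s"
      have x: "x \<ge> 0" using s by (simp add: x_def)
      have "\<bar>fst z / real n - snd z\<bar> = \<bar>dev 1 (real n) z\<bar> / real n"
        using n by (simp add: dev_def field_simps abs_if)
      also have "\<dots> = x / s" using s by (simp add: x_def flip: s(2))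
      finally have "\<bar>fst z / real n - snd z\<bar> powr p = x powr p * s powr (- p)"
        using x s by (simp add: powr_divide powr_minus_divide)
      also have "\<dots> \<le> (1 + x ^ (2*m)) * s powr (- p)"
      proof (rule mult_right_mono)
        have ev: "0 \<le> x ^ (2*m)" using x by simp
        show "x powr p \<le> 1 + x ^ (2*m)"
        proof (cases "x \<le> 1")
          case True
          then have "x powr p \<le> 1" using x p by (intro powr_le1) auto
          then show ?thesis using ev by linarith
        next
          case False
          then have "x powr p \<le> x powr real (2*m)" using m by (intro powr_mono) auto
          also have "\<dots> = x ^ (2*m)" using False by (intro powr_realpow) simp
          finally show ?thesis by simp
        qed
      qed simp
      also have "x ^ (2*m) = dev 1 (real n) z ^ (2*m) / real n ^ m"
        unfolding x_def power_divide power_mult using s(2) by (simp add: power2_eq_square)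
      finally show "\<bar>fst z / real n - snd z\<bar> powr p \<le> s powr (- p) * (1 + dev 1 (real n) z ^ (2*m) / real n ^ m)"
        by (simp add: mult.commute)
    qed simp
    also have "\<dots> \<le> ennreal ((1 + K) * real n powr (- p / 2))"
    proof (rule ennreal_leI)
      have "(\<integral>z. s powr (- p) * (1 + dev 1 (real n) z ^ (2*m) / real n ^ m) \<partial>cpl n)
         = s powr (- p) * (1 + moment 1 m n / real n ^ m)"
        using integrable_dev[OF scaled_moments_1[OF weak], of n "real n" "2*m"]
          C.prob_space by (simp add: moment_def)
      also have "\<dots> \<le> s powr (- p) * (1 + K)"
        using K(2)[of n] n by (intro mult_left_mono add_left_mono) (auto simp: divide_le_eq)
      also have "\<dots> = (1 + K) * real n powr (- p / 2)"
        by (simp add: s_def powr_half_sqrt[symmetric] powr_powr)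
      finally show "(\<integral>z. s powr (- p) * (1 + dev 1 (real n) z ^ (2*m) / real n ^ m) \<partial>cpl n) \<le> (1 + K) * real n powr (- p / 2)" .
    qed
    finally show ?thesis .
  qed
  then show ?thesis using K by (intro exI[of _ "1 + K"]) auto
qed

end

theorem theorem3p1:
  fixes p :: real and Y :: "real measure"
  assumes "p \<ge> 1" and "is_limit_law Y"
  shows "\<exists>c::real. \<forall>n::nat. n \<ge> 1 \<longrightarrow> dp p (Y_law n) Y \<le> ennreal (c / sqrt (real n))"
proof -
  interpret real_distribution Y using assms(2) by (simp add: is_limit_law_def)
  interpret quicksort_fixpoint Y
    using assms(2) by unfold_locales (auto simp: is_limit_law_def)
  have weak: "weak_conv_m Y_law Y" using assms(2) by (simp add: is_limit_law_def)
  obtain K where K: "K \<ge> 0" "\<And>n. n \<ge> 1 \<Longrightarrow> wass_pow p (Y_law n) Y \<le> ennreal (K * real n powr (- p / 2))"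
    using wass_pow_le[OF weak, of p] assms(1) by auto
  have "dp p (Y_law n) Y \<le> ennreal (K powr (1 / p) / sqrt (real n))" if n: "n \<ge> 1" for n
  proof -
    \<comment> \<open>Finiteness excludes the branch of \<open>dp\<close> with value
      \<open>\<top>\<close>, so the root may be taken in the reals.\<close>
    have fin: "wass_pow p (Y_law n) Y \<noteq> \<top>" using K(2)[OF n] by (auto simp: top_unique)
    have "enn2real (wass_pow p (Y_law n) Y) \<le> K * real n powr (- p / 2)"
      using K by (intro enn2real_leI K(2) n) auto
    then have "enn2real (wass_pow p (Y_law n) Y) powr (1 / p) \<le> (K * real n powr (- p / 2)) powr (1 / p)"
      using assms(1) by (intro powr_mono2) auto
    also have "\<dots> = K powr (1 / p) * real n powr (- 1 / 2)"
      using K(1) assms(1) by (simp add: powr_mult powr_powr)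
    also have "\<dots> = K powr (1 / p) / sqrt (real n)"
      using n by (simp add: powr_minus_divide powr_half_sqrt)
    finally show ?thesis using fin by (simp add: dp_def ennreal_leI)
  qed
  then show ?thesis by blast
qed

end
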